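(* Let $(H,\mu_H,\Delta_H,\alpha_H,\beta_H,\psi_H,\omega_H)$ be a BiHom-bialgebra and $(A,\mu_A,\alpha_A,\beta_A)$ a left $H$-module BiHom-algebra, with action $H\otimes A\to A$, $h\otimes a\mapsto h\cdot a$, and assume that all structure maps $\alpha_H,\beta_H,\psi_H,\omega_H,\alpha_A,\beta_A$ are bijective. Let $m,n,p\in\mathbb Z$. Define the linear map $$R_{m,n,p}:H\otimes A\to A\otimes H,\qquad R_{m,n,p}(h\otimes a)=\alpha_H^m\beta_H^n\omega_H^p(h_1)\cdot\beta_A^{-1}(a)\otimes\psi_H^{-1}(h_2).$$ Then $R_{m,n,p}$ is a BiHom-twisting map between $A$ and $H$.
   Context: All vector spaces are over a field $\Bbbk$; (co)algebras are not assumed (co)unital; multiplications are written by juxtaposition and $\Delta(h)=h_1\otimes h_2$ (Sweedler). A BiHom-associative algebra $(A,\mu,\alpha,\beta)$: $\mu:A\otimes A\to A$, $\alpha,\beta:A\to A$ linear with $\alpha\beta=\beta\alpha$, $\alpha(aa')=\alpha(a)\alpha(a')$, $\beta(aa')=\beta(a)\beta(a')$, $\alpha(a)(a'a'')=(aa')\beta(a'')$. A BiHom-coassociative coalgebra $(C,\Delta,\psi,\omega)$: $\Delta:C\to C\otimes C$, $\psi,\omega:C\to C$ linear with $\psi\omega=\omega\psi$, $(\psi\otimes\psi)\Delta=\Delta\psi$, $(\omega\otimes\omega)\Delta=\Delta\omega$, $(\Delta\otimes\psi)\Delta=(\omega\otimes\Delta)\Delta$. A BiHom-bialgebra $(H,\mu,\Delta,\alpha,\beta,\psi,\omega)$: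 $(H,\mu,\alpha,\beta)$ is a BiHom-associative algebra, $(H,\Delta,\psi,\omega)$ is a BiHom-coassociative coalgebra, $\Delta(hh')=h_1h'_1\otimes h_2h'_2$, each of $\alpha,\beta$ commutes with each of $\psi,\omega$, $(\alpha\otimes\alpha)\Delta=\Delta\alpha$, $(\beta\otimes\beta)\Delta=\Delta\beta$, and $\psi,\omega$ are multiplicative. A left module over a BiHom-associative algebra $(H,\mu_H,\alpha_H,\beta_H)$ is a triple $(M,\alpha_M,\beta_M)$, $\alpha_M,\beta_M:M\to M$ commuting linear maps, with a linear map $H\otimes M\to M$, $h\otimes m\mapsto h\cdot m$, such that $\alpha_M(h\cdot m)=\alpha_H(h)\cdot\alpha_M(m)$, $\beta_M(h\cdot m)=\beta_H(h)\cdot\beta_M(m)$, $\alpha_H(h)\cdot(h'\cdot m)=(hh')\cdot\beta_M(m)$. If $H$ is a BiHom-bialgebra with $\alpha_H,\beta_H,\psi_H,\omega_H$ bijective, a left $H$-module BiHom-algebra is a BiHom-associative algebra $(A,\mu_A,\alpha_A,\beta_A)$ such that $(A,\alpha_A,\beta_A)$ is a left $H$-module and $h\cdot(aa')=[\alpha_H^{-1}(\omega_H^{-1}(h_1))\cdot a][\beta_H^{-1}(\psi_H^{-1}(h_2))\cdot a']$ for all $h\in H$, $a,a'\in A$. For BiHom-associative algebras $A,B$ with bijective structure maps, a BiHom-twisting map between $A$ and $B$ is a linear map $R:B\otimes A\to A\otimes B$ with $(\alpha_A\otimes\alpha_B)R=R(\alpha_B\otimes\alpha_A)$, $(\beta_A\otimes\beta_B)R=R(\beta_B\otimes\beta_A)$,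 $R\circ(\alpha_B\otimes\mu_A)=(\mu_A\otimes\beta_B)\circ(\mathrm{id}_A\otimes R)\circ(\mathrm{id}_A\otimes\alpha_B\beta_B^{-1}\otimes\mathrm{id}_A)\circ(R\otimes\mathrm{id}_A)$, $R\circ(\mu_B\otimes\beta_A)=(\alpha_A\otimes\mu_B)\circ(R\otimes\mathrm{id}_B)\circ(\mathrm{id}_B\otimes\alpha_A^{-1}\beta_A\otimes\mathrm{id}_B)\circ(\mathrm{id}_B\otimes R)$. *)

theory Defs
  imports "HOL-Algebra.AbelCoset" "Jordan_Normal_Form.Missing_VectorSpace"
begin

text \<open>
  Vector spaces are the carrier-based ones: \<open>vectorspace K V\<close> and \<open>linear_map K V W T\<close>.
  All maps are total functions of which only the values on the carrier matter.
  \<open>free_space K S\<close> is the vector space of finitely supported functions from \<open>S\<close> to \<open>K\<close>,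
  extended by zero outside \<open>S\<close>; the fields \<open>mult\<close> and \<open>one\<close>, which a module record
  inherits from rings, are irrelevant.
\<close>

definition free_space :: "'k ring \<Rightarrow> 'x set \<Rightarrow> ('k, 'x \<Rightarrow> 'k) module" where
  "free_space K S =
    \<lparr>carrier = {f. range f \<subseteq> carrier K \<and> finite {x. f x \<noteq> \<zero>\<^bsub>K\<^esub>} \<and> {x. f x \<noteq> \<zero>\<^bsub>K\<^esub>} \<subseteq> S},
     mult = (\<lambda>f g x. \<zero>\<^bsub>K\<^esub>), one = (\<lambda>x. \<zero>\<^bsub>K\<^esub>),
     zero = (\<lambda>x. \<zero>\<^bsub>K\<^esub>), add = (\<lambda>f g x. f x \<oplus>\<^bsub>K\<^esub> g x),
     smult = (\<lambda>c f x. c \<otimes>\<^bsub>K\<^esub> f x)\<rparr>"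

definition free_gen :: "'k ring \<Rightarrow> 'x \<Rightarrow> 'x \<Rightarrow> 'k" where
  "free_gen K x = (\<lambda>y. if y = x then \<one>\<^bsub>K\<^esub> else \<zero>\<^bsub>K\<^esub>)"

definition quotient_space :: "('k, 'v) module \<Rightarrow> 'v set \<Rightarrow> ('k, 'v set) module" where
  "quotient_space V W =
    \<lparr>carrier = a_rcosets\<^bsub>V\<^esub> W,
     mult = (\<lambda>X Y. W), one = W,
     zero = W, add = (\<lambda>X Y. X <+>\<^bsub>V\<^esub> Y),
     smult = (\<lambda>c X. \<Union>x\<in>X. W +>\<^bsub>V\<^esub> (c \<odot>\<^bsub>V\<^esub> x))\<rparr>"

definition tensor_relations ::
  "'k ring \<Rightarrow> ('k, 'a) module \<Rightarrow> ('k, 'b) module \<Rightarrow> ('a \<times> 'b \<Rightarrow> 'k) set" where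
  "tensor_relations K M N =
    (let F = free_space K (carrier M \<times> carrier N); e = free_gen K in
      {e (x \<oplus>\<^bsub>M\<^esub> x', y) \<ominus>\<^bsub>F\<^esub> (e (x, y) \<oplus>\<^bsub>F\<^esub> e (x', y)) | x x' y.
         x \<in> carrier M \<and> x' \<in> carrier M \<and> y \<in> carrier N} \<union>
      {e (x, y \<oplus>\<^bsub>N\<^esub> y') \<ominus>\<^bsub>F\<^esub> (e (x, y) \<oplus>\<^bsub>F\<^esub> e (x, y')) | x y y'.
         x \<in> carrier M \<and> y \<in> carrier N \<and> y' \<in> carrier N} \<union>
      {e (c \<odot>\<^bsub>M\<^esub> x, y) \<ominus>\<^bsub>F\<^esub> c \<odot>\<^bsub>F\<^esub> e (x, y) | c x y.
         c \<in> carrier K \<and> x \<in> carrier M \<and> y \<in> carrier N} \<union>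
      {e (x, c \<odot>\<^bsub>N\<^esub> y) \<ominus>\<^bsub>F\<^esub> c \<odot>\<^bsub>F\<^esub> e (x, y) | c x y.
         c \<in> carrier K \<and> x \<in> carrier M \<and> y \<in> carrier N})"

definition tensor_kernel ::
  "'k ring \<Rightarrow> ('k, 'a) module \<Rightarrow> ('k, 'b) module \<Rightarrow> ('a \<times> 'b \<Rightarrow> 'k) set" where
  "tensor_kernel K M N =
    LinearCombinations.module.span K (free_space K (carrier M \<times> carrier N)) (tensor_relations K M N)"

definition tensor ::
  "'k ring \<Rightarrow> ('k, 'a) module \<Rightarrow> ('k, 'b) module \<Rightarrow> ('k, ('a \<times> 'b \<Rightarrow> 'k) set) module" where
  "tensor K M N =
    quotient_space (free_space K (carrier M \<times> carrier N)) (tensor_kernel K M N)"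

definition pure_tensor ::
  "'k ring \<Rightarrow> ('k, 'a) module \<Rightarrow> ('k, 'b) module \<Rightarrow> 'a \<Rightarrow> 'b \<Rightarrow> ('a \<times> 'b \<Rightarrow> 'k) set" where
  "pure_tensor K M N x y =
    tensor_kernel K M N +>\<^bsub>free_space K (carrier M \<times> carrier N)\<^esub> free_gen K (x, y)"

text \<open>
  For a bilinear map \<open>b\<close> from \<open>M\<close> and \<open>N\<close> to \<open>P\<close>, \<open>tensor_lift K P b\<close> is the linear map from
  \<open>tensor K M N\<close> to \<open>P\<close> with \<open>x \<otimes> y \<mapsto> b x y\<close>. It evaluates \<open>b\<close> on a representative; for bilinear
  \<open>b\<close> all representatives give the same value, so the image below is a singleton.
\<close>

definition tensor_lift ::
  "'k ring \<Rightarrow> ('k, 'p) module \<Rightarrow> ('a \<Rightarrow> 'b \<Rightarrow> 'p) \<Rightarrow> ('a \<times> 'b \<Rightarrow> 'k) set \<Rightarrow> 'p" where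
  "tensor_lift K P b t =
    the_elem ((\<lambda>f. \<Oplus>\<^bsub>P\<^esub>z\<in>{z. f z \<noteq> \<zero>\<^bsub>K\<^esub>}. f z \<odot>\<^bsub>P\<^esub> b (fst z) (snd z)) ` t)"

text \<open>
  The tensor product \<open>f \<otimes> g\<close> of linear maps; \<open>M'\<close> and \<open>N'\<close> are the codomains of \<open>f\<close> and \<open>g\<close>.
  Applied to a coproduct, \<open>tensor_map K M' N' f g (\<Delta> h)\<close> is the Sweedler expression
  \<open>f h\<^sub>1 \<otimes> g h\<^sub>2\<close>.
\<close>

definition tensor_map ::
  "'k ring \<Rightarrow> ('k, 'c) module \<Rightarrow> ('k, 'd) module \<Rightarrow> ('a \<Rightarrow> 'c) \<Rightarrow> ('b \<Rightarrow> 'd) \<Rightarrow>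
     ('a \<times> 'b \<Rightarrow> 'k) set \<Rightarrow> ('c \<times> 'd \<Rightarrow> 'k) set" where
  "tensor_map K M' N' f g =
    tensor_lift K (tensor K M' N') (\<lambda>x y. pure_tensor K M' N' (f x) (g y))"

text \<open>
  The canonical isomorphism from \<open>(M \<otimes> N) \<otimes> P\<close> to \<open>M \<otimes> (N \<otimes> P)\<close> and its inverse, which are
  left implicit on paper.
\<close>

definition tensor_assoc ::
  "'k ring \<Rightarrow> ('k, 'a) module \<Rightarrow> ('k, 'b) module \<Rightarrow> ('k, 'c) module \<Rightarrow>
     (('a \<times> 'b \<Rightarrow> 'k) set \<times> 'c \<Rightarrow> 'k) set \<Rightarrow> ('a \<times> ('b \<times> 'c \<Rightarrow> 'k) set \<Rightarrow> 'k) set" where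
  "tensor_assoc K M N P =
    (let T = tensor K M (tensor K N P) in
      tensor_lift K T (\<lambda>t z. tensor_lift K T
        (\<lambda>x y. pure_tensor K M (tensor K N P) x (pure_tensor K N P y z)) t))"

definition tensor_unassoc ::
  "'k ring \<Rightarrow> ('k, 'a) module \<Rightarrow> ('k, 'b) module \<Rightarrow> ('k, 'c) module \<Rightarrow>
     ('a \<times> ('b \<times> 'c \<Rightarrow> 'k) set \<Rightarrow> 'k) set \<Rightarrow> (('a \<times> 'b \<Rightarrow> 'k) set \<times> 'c \<Rightarrow> 'k) set" where
  "tensor_unassoc K M N P =
    (let T = tensor K (tensor K M N) P in
      tensor_lift K T (\<lambda>x t. tensor_lift K T
        (\<lambda>y z. pure_tensor K (tensor K M N) P (pure_tensor K M N x y) z) t))"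

abbreviation bij_map :: "('k, 'v) module \<Rightarrow> ('v \<Rightarrow> 'v) \<Rightarrow> bool" where
  "bij_map V f \<equiv> bij_betw f (carrier V) (carrier V)"

abbreviation inv_map :: "('k, 'v) module \<Rightarrow> ('v \<Rightarrow> 'v) \<Rightarrow> 'v \<Rightarrow> 'v" where
  "inv_map V f \<equiv> inv_into (carrier V) f"

definition int_power :: "('k, 'v) module \<Rightarrow> ('v \<Rightarrow> 'v) \<Rightarrow> int \<Rightarrow> 'v \<Rightarrow> 'v" where
  "int_power V f k = (if k \<ge> 0 then f ^^ nat k else inv_map V f ^^ nat (- k))"

locale bihom_algebra =
  fixes K :: "'k ring" and A :: "('k, 'a) module"
    and \<mu> :: "('a \<times> 'a \<Rightarrow> 'k) set \<Rightarrow> 'a" and \<alpha> \<beta> :: "'a \<Rightarrow> 'a"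
  assumes mult_linear: "linear_map K (tensor K A A) A \<mu>"
    and alpha_linear: "linear_map K A A \<alpha>"
    and beta_linear: "linear_map K A A \<beta>"
    and alpha_beta: "\<And>a. a \<in> carrier A \<Longrightarrow> \<alpha> (\<beta> a) = \<beta> (\<alpha> a)"
    and alpha_mult: "\<And>a a'. a \<in> carrier A \<Longrightarrow> a' \<in> carrier A \<Longrightarrow>
      \<alpha> (\<mu> (pure_tensor K A A a a')) = \<mu> (pure_tensor K A A (\<alpha> a) (\<alpha> a'))"
    and beta_mult: "\<And>a a'. a \<in> carrier A \<Longrightarrow> a' \<in> carrier A \<Longrightarrow>
      \<beta> (\<mu> (pure_tensor K A A a a')) = \<mu> (pure_tensor K A A (\<beta> a) (\<beta> a'))"
    and bihom_assoc: "\<And>a a' a''. a \<in> carrier A \<Longrightarrow> a' \<in> carrier A \<Longrightarrow> a'' \<in> carrier A \<Longrightarrow>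
      \<mu> (pure_tensor K A A (\<alpha> a) (\<mu> (pure_tensor K A A a' a''))) =
      \<mu> (pure_tensor K A A (\<mu> (pure_tensor K A A a a')) (\<beta> a''))"

locale bihom_coalgebra =
  fixes K :: "'k ring" and C :: "('k, 'c) module"
    and \<Delta> :: "'c \<Rightarrow> ('c \<times> 'c \<Rightarrow> 'k) set" and \<psi> \<omega> :: "'c \<Rightarrow> 'c"
  assumes comult_linear: "linear_map K C (tensor K C C) \<Delta>"
    and psi_linear: "linear_map K C C \<psi>"
    and omega_linear: "linear_map K C C \<omega>"
    and psi_omega: "\<And>c. c \<in> carrier C \<Longrightarrow> \<psi> (\<omega> c) = \<omega> (\<psi> c)"
    and psi_comult: "\<And>c. c \<in> carrier C \<Longrightarrow> tensor_map K C C \<psi> \<psi> (\<Delta> c) = \<Delta> (\<psi> c)"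
    and omega_comult: "\<And>c. c \<in> carrier C \<Longrightarrow> tensor_map K C C \<omega> \<omega> (\<Delta> c) = \<Delta> (\<omega> c)"
    and bihom_coassoc: "\<And>c. c \<in> carrier C \<Longrightarrow>
      tensor_assoc K C C C (tensor_map K (tensor K C C) C \<Delta> \<psi> (\<Delta> c)) =
      tensor_map K C (tensor K C C) \<omega> \<Delta> (\<Delta> c)"

locale bihom_bialgebra =
  bihom_algebra K H \<mu> \<alpha> \<beta> + bihom_coalgebra K H \<Delta> \<psi> \<omega>
  for K :: "'k ring" and H :: "('k, 'h) module"
    and \<mu> :: "('h \<times> 'h \<Rightarrow> 'k) set \<Rightarrow> 'h" and \<Delta> :: "'h \<Rightarrow> ('h \<times> 'h \<Rightarrow> 'k) set"
    and \<alpha> \<beta> \<psi> \<omega> :: "'h \<Rightarrow> 'h" +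
  assumes comult_mult: "\<And>h h'. h \<in> carrier H \<Longrightarrow> h' \<in> carrier H \<Longrightarrow>
      \<Delta> (\<mu> (pure_tensor K H H h h')) =
      tensor_lift K (tensor K H H)
        (\<lambda>h1 h2. tensor_map K H H (\<lambda>h1'. \<mu> (pure_tensor K H H h1 h1'))
                                  (\<lambda>h2'. \<mu> (pure_tensor K H H h2 h2')) (\<Delta> h'))
        (\<Delta> h)"
    and alpha_psi: "\<And>h. h \<in> carrier H \<Longrightarrow> \<alpha> (\<psi> h) = \<psi> (\<alpha> h)"
    and alpha_omega: "\<And>h. h \<in> carrier H \<Longrightarrow> \<alpha> (\<omega> h) = \<omega> (\<alpha> h)"
    and beta_psi: "\<And>h. h \<in> carrier H \<Longrightarrow> \<beta> (\<psi> h) = \<psi> (\<beta> h)"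
    and beta_omega: "\<And>h. h \<in> carrier H \<Longrightarrow> \<beta> (\<omega> h) = \<omega> (\<beta> h)"
    and alpha_comult: "\<And>h. h \<in> carrier H \<Longrightarrow> tensor_map K H H \<alpha> \<alpha> (\<Delta> h) = \<Delta> (\<alpha> h)"
    and beta_comult: "\<And>h. h \<in> carrier H \<Longrightarrow> tensor_map K H H \<beta> \<beta> (\<Delta> h) = \<Delta> (\<beta> h)"
    and psi_mult: "\<And>h h'. h \<in> carrier H \<Longrightarrow> h' \<in> carrier H \<Longrightarrow>
      \<psi> (\<mu> (pure_tensor K H H h h')) = \<mu> (pure_tensor K H H (\<psi> h) (\<psi> h'))"
    and omega_mult: "\<And>h h'. h \<in> carrier H \<Longrightarrow> h' \<in> carrier H \<Longrightarrow>
      \<omega> (\<mu> (pure_tensor K H H h h')) = \<mu> (pure_tensor K H H (\<omega> h) (\<omega> h'))"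

locale bihom_left_module =
  H: bihom_algebra K H \<mu>\<^sub>H \<alpha>\<^sub>H \<beta>\<^sub>H
  for K :: "'k ring" and H :: "('k, 'h) module"
    and \<mu>\<^sub>H :: "('h \<times> 'h \<Rightarrow> 'k) set \<Rightarrow> 'h" and \<alpha>\<^sub>H \<beta>\<^sub>H :: "'h \<Rightarrow> 'h" +
  fixes M :: "('k, 'm) module" and \<alpha>\<^sub>M \<beta>\<^sub>M :: "'m \<Rightarrow> 'm"
    and act :: "('h \<times> 'm \<Rightarrow> 'k) set \<Rightarrow> 'm"
  assumes alpha_linear: "linear_map K M M \<alpha>\<^sub>M"
    and beta_linear: "linear_map K M M \<beta>\<^sub>M"
    and act_linear: "linear_map K (tensor K H M) M act"
    and alpha_beta: "\<And>x. x \<in> carrier M \<Longrightarrow> \<alpha>\<^sub>M (\<beta>\<^sub>M x) = \<beta>\<^sub>M (\<alpha>\<^sub>M x)"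
    and alpha_act: "\<And>h x. h \<in> carrier H \<Longrightarrow> x \<in> carrier M \<Longrightarrow>
      \<alpha>\<^sub>M (act (pure_tensor K H M h x)) = act (pure_tensor K H M (\<alpha>\<^sub>H h) (\<alpha>\<^sub>M x))"
    and beta_act: "\<And>h x. h \<in> carrier H \<Longrightarrow> x \<in> carrier M \<Longrightarrow>
      \<beta>\<^sub>M (act (pure_tensor K H M h x)) = act (pure_tensor K H M (\<beta>\<^sub>H h) (\<beta>\<^sub>M x))"
    and act_act: "\<And>h h' x. h \<in> carrier H \<Longrightarrow> h' \<in> carrier H \<Longrightarrow> x \<in> carrier M \<Longrightarrow>
      act (pure_tensor K H M (\<alpha>\<^sub>H h) (act (pure_tensor K H M h' x))) =
      act (pure_tensor K H M (\<mu>\<^sub>H (pure_tensor K H H h h')) (\<beta>\<^sub>M x))"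

locale left_module_bihom_algebra =
  H: bihom_bialgebra K H \<mu>\<^sub>H \<Delta>\<^sub>H \<alpha>\<^sub>H \<beta>\<^sub>H \<psi>\<^sub>H \<omega>\<^sub>H +
  A: bihom_algebra K A \<mu>\<^sub>A \<alpha>\<^sub>A \<beta>\<^sub>A +
  bihom_left_module K H \<mu>\<^sub>H \<alpha>\<^sub>H \<beta>\<^sub>H A \<alpha>\<^sub>A \<beta>\<^sub>A act
  for K :: "'k ring" and H :: "('k, 'h) module"
    and \<mu>\<^sub>H :: "('h \<times> 'h \<Rightarrow> 'k) set \<Rightarrow> 'h" and \<Delta>\<^sub>H :: "'h \<Rightarrow> ('h \<times> 'h \<Rightarrow> 'k) set"
    and \<alpha>\<^sub>H \<beta>\<^sub>H \<psi>\<^sub>H \<omega>\<^sub>H :: "'h \<Rightarrow> 'h"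
    and A :: "('k, 'a) module" and \<mu>\<^sub>A :: "('a \<times> 'a \<Rightarrow> 'k) set \<Rightarrow> 'a" and \<alpha>\<^sub>A \<beta>\<^sub>A :: "'a \<Rightarrow> 'a"
    and act :: "('h \<times> 'a \<Rightarrow> 'k) set \<Rightarrow> 'a" +
  assumes bij_H: "bij_map H \<alpha>\<^sub>H" "bij_map H \<beta>\<^sub>H" "bij_map H \<psi>\<^sub>H" "bij_map H \<omega>\<^sub>H"
    and act_mult: "\<And>h a a'. h \<in> carrier H \<Longrightarrow> a \<in> carrier A \<Longrightarrow> a' \<in> carrier A \<Longrightarrow>
      act (pure_tensor K H A h (\<mu>\<^sub>A (pure_tensor K A A a a'))) =
      \<mu>\<^sub>A (tensor_map K A A
            (\<lambda>h1. act (pure_tensor K H A (inv_map H \<alpha>\<^sub>H (inv_map H \<omega>\<^sub>H h1)) a))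
            (\<lambda>h2. act (pure_tensor K H A (inv_map H \<beta>\<^sub>H (inv_map H \<psi>\<^sub>H h2)) a'))
            (\<Delta>\<^sub>H h))"

text \<open>
  In \<open>twist_mult_A\<close> and \<open>twist_mult_B\<close> the element \<open>t\<close> ranges over the left-nested triple tensor
  products \<open>(B \<otimes> A) \<otimes> A\<close> and \<open>(B \<otimes> B) \<otimes> A\<close>.
\<close>

locale bihom_twisting_map =
  A: bihom_algebra K A \<mu>\<^sub>A \<alpha>\<^sub>A \<beta>\<^sub>A +
  B: bihom_algebra K B \<mu>\<^sub>B \<alpha>\<^sub>B \<beta>\<^sub>B
  for K :: "'k ring"
    and A :: "('k, 'a) module" and \<mu>\<^sub>A :: "('a \<times> 'a \<Rightarrow> 'k) set \<Rightarrow> 'a" and \<alpha>\<^sub>A \<beta>\<^sub>A :: "'a \<Rightarrow> 'a"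
    and B :: "('k, 'b) module" and \<mu>\<^sub>B :: "('b \<times> 'b \<Rightarrow> 'k) set \<Rightarrow> 'b" and \<alpha>\<^sub>B \<beta>\<^sub>B :: "'b \<Rightarrow> 'b" +
  fixes R :: "('b \<times> 'a \<Rightarrow> 'k) set \<Rightarrow> ('a \<times> 'b \<Rightarrow> 'k) set"
  assumes bij_A: "bij_map A \<alpha>\<^sub>A" "bij_map A \<beta>\<^sub>A"
    and bij_B: "bij_map B \<alpha>\<^sub>B" "bij_map B \<beta>\<^sub>B"
    and twist_linear: "linear_map K (tensor K B A) (tensor K A B) R"
    and twist_alpha: "\<And>t. t \<in> carrier (tensor K B A) \<Longrightarrow>
      tensor_map K A B \<alpha>\<^sub>A \<alpha>\<^sub>B (R t) = R (tensor_map K B A \<alpha>\<^sub>B \<alpha>\<^sub>A t)"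
    and twist_beta: "\<And>t. t \<in> carrier (tensor K B A) \<Longrightarrow>
      tensor_map K A B \<beta>\<^sub>A \<beta>\<^sub>B (R t) = R (tensor_map K B A \<beta>\<^sub>B \<beta>\<^sub>A t)"
    and twist_mult_A: "\<And>t. t \<in> carrier (tensor K (tensor K B A) A) \<Longrightarrow>
      R (tensor_map K B A \<alpha>\<^sub>B \<mu>\<^sub>A (tensor_assoc K B A A t)) =
      tensor_map K A B \<mu>\<^sub>A \<beta>\<^sub>B (tensor_unassoc K A A B
        (tensor_map K A (tensor K A B) id R (tensor_assoc K A B A
          (tensor_map K (tensor K A B) A (tensor_map K A B id (\<alpha>\<^sub>B \<circ> inv_map B \<beta>\<^sub>B)) id
            (tensor_map K (tensor K A B) A R id t)))))"
    and twist_mult_B: "\<And>t. t \<in> carrier (tensor K (tensor K B B) A) \<Longrightarrow>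
      R (tensor_map K B A \<mu>\<^sub>B \<beta>\<^sub>A t) =
      tensor_map K A B \<alpha>\<^sub>A \<mu>\<^sub>B (tensor_assoc K A B B
        (tensor_map K (tensor K A B) B R id (tensor_unassoc K B A B
          (tensor_map K B (tensor K A B) id (tensor_map K A B (inv_map A \<alpha>\<^sub>A \<circ> \<beta>\<^sub>A) id)
            (tensor_map K B (tensor K A B) id R (tensor_assoc K B B A t))))))"

text \<open>
  The map \<open>h \<otimes> a \<mapsto> \<alpha>\<^sub>H\<^sup>m \<beta>\<^sub>H\<^sup>n \<omega>\<^sub>H\<^sup>p (h\<^sub>1) \<cdot> \<beta>\<^sub>A\<^sup>-\<^sup>1 (a) \<otimes> \<psi>\<^sub>H\<^sup>-\<^sup>1 (h\<^sub>2)\<close>.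
\<close>

definition R_map ::
  "'k ring \<Rightarrow> ('k, 'h) module \<Rightarrow> ('h \<Rightarrow> ('h \<times> 'h \<Rightarrow> 'k) set) \<Rightarrow>
     ('h \<Rightarrow> 'h) \<Rightarrow> ('h \<Rightarrow> 'h) \<Rightarrow> ('h \<Rightarrow> 'h) \<Rightarrow> ('h \<Rightarrow> 'h) \<Rightarrow>
     ('k, 'a) module \<Rightarrow> ('a \<Rightarrow> 'a) \<Rightarrow> (('h \<times> 'a \<Rightarrow> 'k) set \<Rightarrow> 'a) \<Rightarrow>
     int \<Rightarrow> int \<Rightarrow> int \<Rightarrow> ('h \<times> 'a \<Rightarrow> 'k) set \<Rightarrow> ('a \<times> 'h \<Rightarrow> 'k) set" where
  "R_map K H \<Delta>\<^sub>H \<alpha>\<^sub>H \<beta>\<^sub>H \<psi>\<^sub>H \<omega>\<^sub>H A \<beta>\<^sub>A act m n p =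
    tensor_lift K (tensor K A H)
      (\<lambda>h a. tensor_map K A H
        (\<lambda>h1. act (pure_tensor K H A
          (int_power H \<alpha>\<^sub>H m (int_power H \<beta>\<^sub>H n (int_power H \<omega>\<^sub>H p h1))) (inv_map A \<beta>\<^sub>A a)))
        (inv_map H \<psi>\<^sub>H) (\<Delta>\<^sub>H h))"

end

theory Submission
  imports Defs
begin

text \<open>
  Write \<open>\<Phi> = \<alpha>\<^sub>H\<^sup>m \<beta>\<^sub>H\<^sup>n \<omega>\<^sub>H\<^sup>p\<close>. The only facts about \<open>\<Phi>\<close> that matter are that it is
  multiplicative and comultiplicative and commutes with the structure maps of \<open>H\<close>, so the exponents
  play no role. By \<open>act_mult\<close>, the left-hand side of \<open>twist_mult_A\<close> at \<open>h \<otimes> a \<otimes> a'\<close> is a linear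
  function of \<open>h\<^sub>1\<^sub>1 \<otimes> h\<^sub>1\<^sub>2 \<otimes> \<psi> h\<^sub>2\<close> and the right-hand side is the same function of
  \<open>\<omega> h\<^sub>1 \<otimes> h\<^sub>2\<^sub>1 \<otimes> h\<^sub>2\<^sub>2\<close>, hence they agree by coassociativity; \<open>twist_mult_B\<close> similarly reduces to
  \<open>\<Phi>(h h') \<cdot> a = \<alpha>\<^sub>H \<Phi>(h) \<cdot> (\<Phi>(h') \<cdot> \<beta>\<^sub>A\<^sup>-\<^sup>1 a)\<close> and the multiplicativity of \<open>\<Delta>\<close>.
  Sweedler computations become the extensionality principle \<open>tensor_eqI\<close>: an identity linear in
  \<open>\<Delta> h\<close> is proved with an arbitrary pure tensor \<open>x \<otimes> y\<close> in place of \<open>\<Delta> h\<close>.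
\<close>

section \<open>Linear maps, quotients and free spaces\<close>

lemma linear_mapI:
  assumes "vectorspace K V" and "vectorspace K W"
    and "\<And>x. x \<in> carrier V \<Longrightarrow> f x \<in> carrier W"
    and "\<And>x y. x \<in> carrier V \<Longrightarrow> y \<in> carrier V \<Longrightarrow> f (x \<oplus>\<^bsub>V\<^esub> y) = f x \<oplus>\<^bsub>W\<^esub> f y"
    and "\<And>c x. c \<in> carrier K \<Longrightarrow> x \<in> carrier V \<Longrightarrow> f (c \<odot>\<^bsub>V\<^esub> x) = c \<odot>\<^bsub>W\<^esub> f x"
  shows "linear_map K V W f"
  using assms
  by (auto simp: linear_map_def mod_hom_def mod_hom_axioms_def module_hom_def vectorspace_def)

lemma linear_map_closed: "linear_map K V W f \<Longrightarrow> x \<in> carrier V \<Longrightarrow> f x \<in> carrier W"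
  by (meson linear_map.T_im)

lemma linear_map_add:
  "linear_map K V W f \<Longrightarrow> x \<in> carrier V \<Longrightarrow> y \<in> carrier V \<Longrightarrow>
    f (x \<oplus>\<^bsub>V\<^esub> y) = f x \<oplus>\<^bsub>W\<^esub> f y"
  by (meson linear_map.T_add)

lemma linear_map_smult:
  "linear_map K V W f \<Longrightarrow> c \<in> carrier K \<Longrightarrow> x \<in> carrier V \<Longrightarrow> f (c \<odot>\<^bsub>V\<^esub> x) = c \<odot>\<^bsub>W\<^esub> f x"
  by (meson linear_map.T_smult)

lemma linear_map_domain: "linear_map K V W f \<Longrightarrow> vectorspace K V"
  by (simp add: linear_map_def)

lemma linear_map_codomain: "linear_map K V W f \<Longrightarrow> vectorspace K W"
  by (simp add: linear_map_def)

lemma linear_map_id: "vectorspace K V \<Longrightarrow> linear_map K V V (\<lambda>x. x)"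
  by (rule linear_mapI) simp_all

lemma linear_map_compose:
  "linear_map K U V f \<Longrightarrow> linear_map K V W g \<Longrightarrow> linear_map K U W (\<lambda>x. g (f x))"
  by (rule linear_mapI)
    (simp_all add: linear_map_domain linear_map_codomain linear_map_closed linear_map_add
      linear_map_smult)

lemma linear_map_inv_into:
  assumes f: "linear_map K V W f" and bij: "bij_betw f (carrier V) (carrier W)"
  shows "linear_map K W V (inv_into (carrier V) f)"
proof (rule linear_mapI)
  interpret linear_map K V W f by fact
  have inj: "inj_on f (carrier V)" and surj: "f ` carrier V = carrier W"
    using bij by (auto simp: bij_betw_def)
  let ?g = "inv_into (carrier V) f"
  show closed: "?g x \<in> carrier V" if "x \<in> carrier W" for x
    using that surj by (metis inv_into_into)
  have fg: "f (?g x) = x" if "x \<in> carrier W" for x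
    using that surj by (metis f_inv_into_f)
  show "?g (x \<oplus>\<^bsub>W\<^esub> y) = ?g x \<oplus>\<^bsub>V\<^esub> ?g y" if "x \<in> carrier W" "y \<in> carrier W" for x y
    by (rule inv_into_f_eq[OF inj]) (simp_all add: closed fg that)
  show "?g (c \<odot>\<^bsub>W\<^esub> x) = c \<odot>\<^bsub>V\<^esub> ?g x" if "c \<in> carrier K" "x \<in> carrier W" for c x
    by (rule inv_into_f_eq[OF inj]) (simp_all add: closed fg that)
qed (use f in \<open>simp_all add: linear_map_def\<close>)

section \<open>Submodules and quotient spaces\<close>

text \<open>Closure under negation is closure under scaling by -1.\<close>

lemma submodule_subgroup:
  assumes "vectorspace K V" and "submodule K W V"
  shows "subgroup W (add_monoid V)"
proof -
  interpret vectorspace K V by fact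
  interpret W: submodule K W V by fact
  have "\<ominus>\<^bsub>V\<^esub> x \<in> W" if "x \<in> W" for x
    using that W.subset W.smult_closed[of "\<ominus>\<^bsub>K\<^esub> \<one>\<^bsub>K\<^esub>" x]
    by (simp add: smult_minus_1 subset_iff)
  then show ?thesis
    using W.subset by (intro add.subgroupI) (auto intro: W.zero_closed)
qed

text \<open>A class is scaled by taking the union of the cosets of \<open>c \<odot> y\<close> over
  all its members \<open>y\<close>. Two members differ by an element of \<open>W\<close>, which
  stays in \<open>W\<close> after scaling, so these cosets coincide. All operations thus become
  operations on representatives, and the axioms are inherited from \<open>V\<close>.\<close>

lemma vectorspace_quotient:
  assumes V: "vectorspace K V" and W: "submodule K W V"
  shows "vectorspace K (quotient_space V W)"
    and "linear_map K V (quotient_space V W) (\<lambda>x. W +>\<^bsub>V\<^esub> x)"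
proof -
  interpret vectorspace K V by fact
  interpret W: submodule K W V by fact
  interpret W: abelian_subgroup W V
    by (intro abelian_subgroupI3 additive_subgroupI submodule_subgroup[OF V W])
      (rule abelian_group_axioms)
  let ?Q = "quotient_space V W"
  have carr: "carrier ?Q = (\<lambda>x. W +>\<^bsub>V\<^esub> x) ` carrier V"
    by (auto simp: quotient_space_def A_RCOSETS_def')
  have add: "(W +>\<^bsub>V\<^esub> x) \<oplus>\<^bsub>?Q\<^esub> (W +>\<^bsub>V\<^esub> y) = W +>\<^bsub>V\<^esub> (x \<oplus>\<^bsub>V\<^esub> y)"
    if "x \<in> carrier V" "y \<in> carrier V" for x y
    using that by (simp add: quotient_space_def W.a_rcos_sum)
  have coset: "W +>\<^bsub>V\<^esub> (w \<oplus>\<^bsub>V\<^esub> x) = W +>\<^bsub>V\<^esub> x" if "w \<in> W" "x \<in> carrier V" for w x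
    using that W.subset
    by (metis W.a_subgroup a_coset_add_assoc a_coset_join2 subset_iff)
  have smult: "c \<odot>\<^bsub>?Q\<^esub> (W +>\<^bsub>V\<^esub> x) = W +>\<^bsub>V\<^esub> (c \<odot>\<^bsub>V\<^esub> x)"
    if c: "c \<in> carrier K" and x: "x \<in> carrier V" for c x
  proof -
    have "W +>\<^bsub>V\<^esub> (c \<odot>\<^bsub>V\<^esub> y) = W +>\<^bsub>V\<^esub> (c \<odot>\<^bsub>V\<^esub> x)" if y: "y \<in> W +>\<^bsub>V\<^esub> x" for y
    proof -
      obtain w where "w \<in> W" "y = w \<oplus>\<^bsub>V\<^esub> x"
        using y by (auto simp: a_r_coset_def')
      then show ?thesis
        using c x W.subset by (simp add: smult_r_distr coset subset_iff)
    qed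
    \<comment> \<open>The index set of the union is nonempty; an empty union would not be the common
      coset.\<close>
    moreover have "x \<in> W +>\<^bsub>V\<^esub> x"
      using x by (rule W.a_rcos_self)
    ultimately have "(\<Union>y\<in>W +>\<^bsub>V\<^esub> x. W +>\<^bsub>V\<^esub> (c \<odot>\<^bsub>V\<^esub> y)) = W +>\<^bsub>V\<^esub> (c \<odot>\<^bsub>V\<^esub> x)"
      by blast
    then show ?thesis
      by (simp add: quotient_space_def)
  qed
  have zero: "\<zero>\<^bsub>?Q\<^esub> = W +>\<^bsub>V\<^esub> \<zero>\<^bsub>V\<^esub>"
    using W.subset by (simp add: quotient_space_def)
  show Q: "vectorspace K ?Q"
  proof (rule vs_criteria)
    show "field K" by (rule field_axioms)
    show "\<forall>v\<in>carrier ?Q. \<exists>u\<in>carrier ?Q. v \<oplus>\<^bsub>?Q\<^esub> u = \<zero>\<^bsub>?Q\<^esub>"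
      by (auto simp: carr add zero r_neg intro!: bexI[of _ "\<ominus>\<^bsub>V\<^esub> _"])
  qed (auto simp: carr add zero smult a_ac smult_assoc1 smult_l_distr smult_r_distr)
  show "linear_map K V ?Q (\<lambda>x. W +>\<^bsub>V\<^esub> x)"
    by (rule linear_mapI[OF V Q]) (auto simp: carr add smult)
qed

section \<open>Free vector spaces and their generators\<close>

lemma free_space_carrier_iff:
  "f \<in> carrier (free_space K S) \<longleftrightarrow>
    (\<forall>x. f x \<in> carrier K) \<and> finite {x. f x \<noteq> \<zero>\<^bsub>K\<^esub>} \<and> (\<forall>x. f x \<noteq> \<zero>\<^bsub>K\<^esub> \<longrightarrow> x \<in> S)"
  by (auto simp: free_space_def)

lemma free_space_ops:
  "\<zero>\<^bsub>free_space K S\<^esub> = (\<lambda>x. \<zero>\<^bsub>K\<^esub>)"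
  "f \<oplus>\<^bsub>free_space K S\<^esub> g = (\<lambda>x. f x \<oplus>\<^bsub>K\<^esub> g x)"
  "c \<odot>\<^bsub>free_space K S\<^esub> f = (\<lambda>x. c \<otimes>\<^bsub>K\<^esub> f x)"
  by (simp_all add: free_space_def)

lemma vectorspace_free_space:
  assumes "field K"
  shows "vectorspace K (free_space K S)"
proof -
  interpret field K by fact
  let ?F = "free_space K S"
  have add: "v \<oplus>\<^bsub>?F\<^esub> w \<in> carrier ?F" if "v \<in> carrier ?F" "w \<in> carrier ?F" for v w
  proof -
    have "finite ({x. v x \<noteq> \<zero>\<^bsub>K\<^esub>} \<union> {x. w x \<noteq> \<zero>\<^bsub>K\<^esub>})"
      using that by (simp add: free_space_carrier_iff)
    then have "finite {x. v x \<oplus>\<^bsub>K\<^esub> w x \<noteq> \<zero>\<^bsub>K\<^esub>}"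
      by (rule rev_finite_subset) auto
    moreover have "x \<in> S" if "v x \<oplus>\<^bsub>K\<^esub> w x \<noteq> \<zero>\<^bsub>K\<^esub>" for x
      using that \<open>v \<in> _\<close> \<open>w \<in> _\<close> by (cases "v x = \<zero>\<^bsub>K\<^esub>") (auto simp: free_space_carrier_iff)
    ultimately show ?thesis
      using that by (simp add: free_space_carrier_iff free_space_ops)
  qed
  have smult: "c \<odot>\<^bsub>?F\<^esub> v \<in> carrier ?F" if "c \<in> carrier K" "v \<in> carrier ?F" for c v
  proof -
    have "finite {x. v x \<noteq> \<zero>\<^bsub>K\<^esub>}"
      using that by (simp add: free_space_carrier_iff)
    then have "finite {x. c \<otimes>\<^bsub>K\<^esub> v x \<noteq> \<zero>\<^bsub>K\<^esub>}"
      by (rule rev_finite_subset) (use that in auto)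
    moreover have "x \<in> S" if "c \<otimes>\<^bsub>K\<^esub> v x \<noteq> \<zero>\<^bsub>K\<^esub>" for x
      using that \<open>c \<in> _\<close> \<open>v \<in> _\<close> by (cases "v x = \<zero>\<^bsub>K\<^esub>") (auto simp: free_space_carrier_iff)
    ultimately show ?thesis
      using that by (simp add: free_space_carrier_iff free_space_ops)
  qed
  show ?thesis
  proof (rule vs_criteria)
    show "field K" by (rule field_axioms)
    show "\<forall>v\<in>carrier ?F. \<exists>u\<in>carrier ?F. v \<oplus>\<^bsub>?F\<^esub> u = \<zero>\<^bsub>?F\<^esub>"
    proof
      fix v assume v: "v \<in> carrier ?F"
      have "v x \<in> carrier K" for x
        using v by (auto simp: free_space_def)
      then have "v \<oplus>\<^bsub>?F\<^esub> ((\<ominus>\<^bsub>K\<^esub> \<one>\<^bsub>K\<^esub>) \<odot>\<^bsub>?F\<^esub> v) = \<zero>\<^bsub>?F\<^esub>"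
        by (simp add: free_space_def fun_eq_iff l_minus r_neg)
      then show "\<exists>u\<in>carrier ?F. v \<oplus>\<^bsub>?F\<^esub> u = \<zero>\<^bsub>?F\<^esub>"
        using smult[OF _ v] by blast
    qed
    show "\<forall>v w. v \<in> carrier ?F \<and> w \<in> carrier ?F \<longrightarrow> v \<oplus>\<^bsub>?F\<^esub> w \<in> carrier ?F"
      using add by blast
    show "\<forall>c v. c \<in> carrier K \<and> v \<in> carrier ?F \<longrightarrow> c \<odot>\<^bsub>?F\<^esub> v \<in> carrier ?F"
      using smult by blast
  qed (auto simp: free_space_carrier_iff free_space_ops fun_eq_iff a_ac m_assoc l_distr r_distr)
qed

lemma free_gen_closed: "field K \<Longrightarrow> z \<in> S \<Longrightarrow> free_gen K z \<in> carrier (free_space K S)"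
proof -
  assume "field K" "z \<in> S"
  then interpret field K by blast
  have "finite {x. free_gen K z x \<noteq> \<zero>\<^bsub>K\<^esub>}"
    by (rule finite_subset[of _ "{z}"]) (auto simp: free_gen_def)
  with \<open>z \<in> S\<close> show ?thesis
    by (auto simp: free_space_def free_gen_def split: if_splits)
qed

text \<open>Finite induction on the support: setting \<open>f\<close> to zero at one support point
  \<open>z\<close> removes \<open>z\<close> from the support, and the removed value times the
  generator at \<open>z\<close> restores \<open>f\<close>.\<close>

lemma free_space_induct [consumes 2, case_names zero add]:
  assumes K: "field K" and f: "f \<in> carrier (free_space K S)"
    and zero: "P \<zero>\<^bsub>free_space K S\<^esub>"
    and add: "\<And>c z g. c \<in> carrier K \<Longrightarrow> z \<in> S \<Longrightarrow> g \<in> carrier (free_space K S) \<Longrightarrow> P g \<Longrightarrow>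
      P (c \<odot>\<^bsub>free_space K S\<^esub> free_gen K z \<oplus>\<^bsub>free_space K S\<^esub> g)"
  shows "P f"
proof -
  interpret field K by fact
  have "finite {x. f x \<noteq> \<zero>\<^bsub>K\<^esub>}"
    using f by (simp add: free_space_def)
  then show ?thesis
    using f
  proof (induction "{x. f x \<noteq> \<zero>\<^bsub>K\<^esub>}" arbitrary: f rule: finite_induct)
    case empty
    then have "f = \<zero>\<^bsub>free_space K S\<^esub>"
      by (auto simp: free_space_def)
    with zero show ?case by simp
  next
    case (insert z X)
    let ?g = "f(z := \<zero>\<^bsub>K\<^esub>)"
    have X: "X = {x. ?g x \<noteq> \<zero>\<^bsub>K\<^esub>}"
      using insert.hyps by auto
    have z: "z \<in> S" "f z \<in> carrier K" and f: "\<And>x. f x \<in> carrier K"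
      using insert by (auto simp: free_space_def)
    have g: "?g \<in> carrier (free_space K S)"
      using insert.prems insert.hyps(1) unfolding X
      by (auto simp: free_space_def)
    have "f = f z \<odot>\<^bsub>free_space K S\<^esub> free_gen K z \<oplus>\<^bsub>free_space K S\<^esub> ?g"
      using f by (auto simp: free_space_def free_gen_def)
    with add[OF z(2,1) g insert.hyps(3)[OF X g]] show ?case by simp
  qed
qed

section \<open>The universal property of the tensor product\<close>

text \<open>\<open>E\<close> is the sum inside \<open>tensor_lift\<close>. The support over which it
  runs changes with \<open>f\<close>, so linearity is obtained after passing to a common index set,
  where the extra terms vanish.\<close>

lemma free_space_extension:
  assumes K: "vectorspace K P" and g: "\<And>z. z \<in> S \<Longrightarrow> g z \<in> carrier P"
  defines "E \<equiv> \<lambda>f. \<Oplus>\<^bsub>P\<^esub>z\<in>{z. f z \<noteq> \<zero>\<^bsub>K\<^esub>}. f z \<odot>\<^bsub>P\<^esub> g z"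
  shows "linear_map K (free_space K S) P E"
    and "z \<in> S \<Longrightarrow> E (free_gen K z) = g z"
proof -
  interpret vectorspace K P by fact
  let ?F = "free_space K S"
  have E: "E f = (\<Oplus>\<^bsub>P\<^esub>z\<in>X. f z \<odot>\<^bsub>P\<^esub> g z)"
    if "f \<in> carrier ?F" "finite X" "{z. f z \<noteq> \<zero>\<^bsub>K\<^esub>} \<subseteq> X" "X \<subseteq> S" for f X
    unfolding E_def
    by (rule add.finprod_mono_neutral_cong_left)
      (use that g in \<open>auto simp: free_space_carrier_iff Pi_iff\<close>)
  have closed: "f z \<odot>\<^bsub>P\<^esub> g z \<in> carrier P" if "f \<in> carrier ?F" "z \<in> S" for f z
    using that g by (simp add: free_space_carrier_iff)
  have supp: "finite {z. f z \<noteq> \<zero>\<^bsub>K\<^esub>}" "{z. f z \<noteq> \<zero>\<^bsub>K\<^esub>} \<subseteq> S" if "f \<in> carrier ?F" for f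
    using that by (auto simp: free_space_carrier_iff)
  show "linear_map K ?F P E"
  proof (rule linear_mapI)
    show F: "vectorspace K ?F"
      by (rule vectorspace_free_space) (rule field_axioms)
    interpret F: vectorspace K ?F by (rule F)
    show "E f \<in> carrier P" if "f \<in> carrier ?F" for f
      unfolding E_def using supp[OF that] closed[OF that] by (auto intro!: finsum_closed)
    show "E (f \<oplus>\<^bsub>?F\<^esub> h) = E f \<oplus>\<^bsub>P\<^esub> E h" if f: "f \<in> carrier ?F" and h: "h \<in> carrier ?F" for f h
    proof -
      \<comment> \<open>A sum can have smaller support than its summands because of cancellation, so
        all three values of \<open>E\<close> are computed over the union.\<close>
      define X where "X = {z. f z \<noteq> \<zero>\<^bsub>K\<^esub>} \<union> {z. h z \<noteq> \<zero>\<^bsub>K\<^esub>}"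
      have X: "finite X" "X \<subseteq> S"
        using supp[OF f] supp[OF h] by (auto simp: X_def)
      have fh: "f z \<in> carrier K" "h z \<in> carrier K" for z
        using f h by (auto simp: free_space_carrier_iff)
      have "E (f \<oplus>\<^bsub>?F\<^esub> h) = (\<Oplus>\<^bsub>P\<^esub>z\<in>X. (f \<oplus>\<^bsub>?F\<^esub> h) z \<odot>\<^bsub>P\<^esub> g z)"
        using f h X by (intro E) (simp_all add: F.a_closed, auto simp: X_def free_space_ops)
      also have "\<dots> = (\<Oplus>\<^bsub>P\<^esub>z\<in>X. f z \<odot>\<^bsub>P\<^esub> g z \<oplus>\<^bsub>P\<^esub> h z \<odot>\<^bsub>P\<^esub> g z)"
        using X fh g closed[OF f] closed[OF h]
        by (intro finsum_cong') (auto simp: free_space_ops smult_l_distr)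
      also have "\<dots> = (\<Oplus>\<^bsub>P\<^esub>z\<in>X. f z \<odot>\<^bsub>P\<^esub> g z) \<oplus>\<^bsub>P\<^esub> (\<Oplus>\<^bsub>P\<^esub>z\<in>X. h z \<odot>\<^bsub>P\<^esub> g z)"
        using X closed[OF f] closed[OF h] by (intro finsum_addf) auto
      also have "\<dots> = E f \<oplus>\<^bsub>P\<^esub> E h"
        using E[OF f X(1) _ X(2)] E[OF h X(1) _ X(2)] by (simp add: X_def)
      finally show ?thesis .
    qed
    show "E (c \<odot>\<^bsub>?F\<^esub> f) = c \<odot>\<^bsub>P\<^esub> E f" if c: "c \<in> carrier K" and f: "f \<in> carrier ?F" for c f
    proof -
      \<comment> \<open>The support of \<open>f\<close> is kept as index set, since for
        \<open>c\<close> zero the support of the scaled function is empty.\<close>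
      let ?X = "{z. f z \<noteq> \<zero>\<^bsub>K\<^esub>}"
      have "E (c \<odot>\<^bsub>?F\<^esub> f) = (\<Oplus>\<^bsub>P\<^esub>z\<in>?X. (c \<odot>\<^bsub>?F\<^esub> f) z \<odot>\<^bsub>P\<^esub> g z)"
        using c f supp[OF f] by (intro E) (simp_all, auto simp: free_space_ops)
      also have "\<dots> = (\<Oplus>\<^bsub>P\<^esub>z\<in>?X. c \<odot>\<^bsub>P\<^esub> (f z \<odot>\<^bsub>P\<^esub> g z))"
        using c f supp[OF f] g closed[OF f]
        by (intro finsum_cong') (auto simp: free_space_ops free_space_carrier_iff smult_assoc1)
      also have "\<dots> = c \<odot>\<^bsub>P\<^esub> E f"
        unfolding E_def using c supp[OF f] closed[OF f]
        by (intro finsum_smult_ldistr[symmetric]) auto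
      finally show ?thesis .
    qed
  qed (rule K)
  show "E (free_gen K z) = g z" if "z \<in> S"
  proof -
    have "{y. free_gen K z y \<noteq> \<zero>\<^bsub>K\<^esub>} = {z}"
      by (auto simp: free_gen_def)
    then show ?thesis
      using g[OF that] by (simp add: E_def free_gen_def)
  qed
qed

section \<open>The tensor relations and the projection onto classes\<close>

lemma tensor_relations_subset:
  assumes "vectorspace K M" "vectorspace K N"
  shows "tensor_relations K M N \<subseteq> carrier (free_space K (carrier M \<times> carrier N))"
proof -
  interpret M: vectorspace K M by fact
  interpret N: vectorspace K N by fact
  let ?F = "free_space K (carrier M \<times> carrier N)"
  interpret F: vectorspace K ?F
    by (rule vectorspace_free_space) (rule M.field_axioms)
  have e: "free_gen K (x, y) \<in> carrier ?F" if "x \<in> carrier M" "y \<in> carrier N" for x y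
    using that by (simp add: free_gen_closed M.field_axioms)
  show ?thesis
    unfolding tensor_relations_def Let_def by (auto simp: e)
qed

lemma tensor_kernel_submodule:
  assumes "vectorspace K M" "vectorspace K N"
  shows "submodule K (tensor_kernel K M N) (free_space K (carrier M \<times> carrier N))"
proof -
  interpret M: vectorspace K M by fact
  interpret F: vectorspace K "free_space K (carrier M \<times> carrier N)"
    by (rule vectorspace_free_space) (rule M.field_axioms)
  show ?thesis
    unfolding tensor_kernel_def by (rule F.span_is_submodule[OF tensor_relations_subset[OF assms]])
qed

lemma vectorspace_tensor: "vectorspace K M \<Longrightarrow> vectorspace K N \<Longrightarrow> vectorspace K (tensor K M N)"
  unfolding tensor_def
  by (intro vectorspace_quotient(1) vectorspace_free_space tensor_kernel_submodule)
    (auto simp: vectorspace_def)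

lemma linear_map_tensor_class:
  assumes "vectorspace K M" "vectorspace K N"
  shows "linear_map K (free_space K (carrier M \<times> carrier N)) (tensor K M N)
    (\<lambda>f. tensor_kernel K M N +>\<^bsub>free_space K (carrier M \<times> carrier N)\<^esub> f)"
  unfolding tensor_def using assms
  by (intro vectorspace_quotient(2) vectorspace_free_space tensor_kernel_submodule)
    (auto simp: vectorspace_def)

text \<open>The projection onto classes is linear and kills the span of the relations, so a relation
  \<open>u \<ominus> v\<close> identifies the classes of \<open>u\<close> and
  \<open>v\<close>.\<close>

lemma tensor_relation_eq_class:
  assumes "vectorspace K M" "vectorspace K N"
    and "u \<ominus>\<^bsub>free_space K (carrier M \<times> carrier N)\<^esub> v \<in> tensor_relations K M N"
    and "u \<in> carrier (free_space K (carrier M \<times> carrier N))"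
    and "v \<in> carrier (free_space K (carrier M \<times> carrier N))"
  shows "tensor_kernel K M N +>\<^bsub>free_space K (carrier M \<times> carrier N)\<^esub> u =
    tensor_kernel K M N +>\<^bsub>free_space K (carrier M \<times> carrier N)\<^esub> v"
proof -
  let ?F = "free_space K (carrier M \<times> carrier N)"
  interpret F: vectorspace K ?F
    using assms by (intro vectorspace_free_space) (simp add: vectorspace_def)
  interpret T: linear_map K ?F "tensor K M N" "\<lambda>f. tensor_kernel K M N +>\<^bsub>?F\<^esub> f"
    using assms by (intro linear_map_tensor_class)
  interpret S: submodule K "tensor_kernel K M N" ?F
    using assms by (intro tensor_kernel_submodule)
  have mem: "u \<ominus>\<^bsub>?F\<^esub> v \<in> tensor_kernel K M N"
    using assms F.in_own_span[OF tensor_relations_subset]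
    unfolding tensor_kernel_def by blast
  have "subgroup (tensor_kernel K M N) (add_monoid ?F)"
    by (rule submodule_subgroup[OF F.vectorspace_axioms S.submodule_axioms])
  then have "tensor_kernel K M N +>\<^bsub>?F\<^esub> (u \<ominus>\<^bsub>?F\<^esub> v) = \<zero>\<^bsub>tensor K M N\<^esub>"
    using mem S.subset by (simp add: F.a_coset_join2 subset_iff tensor_def quotient_space_def)
  then have "(tensor_kernel K M N +>\<^bsub>?F\<^esub> u) \<ominus>\<^bsub>tensor K M N\<^esub> (tensor_kernel K M N +>\<^bsub>?F\<^esub> v) =
      \<zero>\<^bsub>tensor K M N\<^esub>"
    using assms(4,5) by simp
  then show ?thesis
    using assms(4,5) by (simp del: T.f_minus)
qed

section \<open>Bilinear maps, extensionality and lifting\<close>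

text \<open>The vector space conditions are included so that \<open>tensor_lift\<close> applies with
  this predicate as its only premise.\<close>

definition bilinear_map ::
  "'k ring \<Rightarrow> ('k, 'a) module \<Rightarrow> ('k, 'b) module \<Rightarrow> ('k, 'p) module \<Rightarrow> ('a \<Rightarrow> 'b \<Rightarrow> 'p) \<Rightarrow> bool" where
  "bilinear_map K M N P b \<longleftrightarrow> vectorspace K M \<and> vectorspace K N \<and> vectorspace K P \<and>
    (\<forall>y\<in>carrier N. linear_map K M P (\<lambda>x. b x y)) \<and> (\<forall>x\<in>carrier M. linear_map K N P (b x))"

lemma bilinear_mapI:
  assumes "vectorspace K M" "vectorspace K N" "vectorspace K P"
    and "\<And>y. y \<in> carrier N \<Longrightarrow> linear_map K M P (\<lambda>x. b x y)"
    and "\<And>x. x \<in> carrier M \<Longrightarrow> linear_map K N P (b x)"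
  shows "bilinear_map K M N P b"
  using assms by (auto simp: bilinear_map_def)

text \<open>The four families in \<open>tensor_relations\<close> are additivity and homogeneity in
  either slot. \<open>class_eq\<close> turns each of them into an equality of classes, and linearity
  of the projection splits the right-hand side.\<close>

lemma bilinear_map_pure_tensor:
  assumes M: "vectorspace K M" and N: "vectorspace K N"
  shows "bilinear_map K M N (tensor K M N) (pure_tensor K M N)"
proof -
  let ?F = "free_space K (carrier M \<times> carrier N)" and ?T = "tensor K M N"
  interpret M: vectorspace K M by fact
  interpret N: vectorspace K N by fact
  interpret T: linear_map K ?F ?T "\<lambda>f. tensor_kernel K M N +>\<^bsub>?F\<^esub> f"
    using assms by (rule linear_map_tensor_class)
  have e: "free_gen K (x, y) \<in> carrier ?F" if "x \<in> carrier M" "y \<in> carrier N" for x y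
    using that by (simp add: free_gen_closed M.field_axioms)
  note class_eq = tensor_relation_eq_class[OF M N]
  note rel = tensor_relations_def[of K M N, unfolded Let_def]
  note pure = pure_tensor_def[of K M N]
  show ?thesis
  proof (intro bilinear_mapI linear_mapI M N T.W.vectorspace_axioms)
    fix y assume y: "y \<in> carrier N"
    show "pure_tensor K M N x y \<in> carrier ?T" if "x \<in> carrier M" for x
      unfolding pure using e[OF that y] by (rule T.T_im)
    show "pure_tensor K M N (x \<oplus>\<^bsub>M\<^esub> x') y =
        pure_tensor K M N x y \<oplus>\<^bsub>?T\<^esub> pure_tensor K M N x' y"
      if "x \<in> carrier M" "x' \<in> carrier M" for x x'
      unfolding pure
      by (rule trans[OF class_eq T.T_add], unfold rel) (use that y in \<open>blast | simp add: e\<close>)+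
    show "pure_tensor K M N (c \<odot>\<^bsub>M\<^esub> x) y = c \<odot>\<^bsub>?T\<^esub> pure_tensor K M N x y"
      if "c \<in> carrier K" "x \<in> carrier M" for c x
      unfolding pure
      by (rule trans[OF class_eq T.T_smult], unfold rel) (use that y in \<open>blast | simp add: e\<close>)+
  next
    fix x assume x: "x \<in> carrier M"
    show "pure_tensor K M N x y \<in> carrier ?T" if "y \<in> carrier N" for y
      unfolding pure using e[OF x that] by (rule T.T_im)
    show "pure_tensor K M N x (y \<oplus>\<^bsub>N\<^esub> y') =
        pure_tensor K M N x y \<oplus>\<^bsub>?T\<^esub> pure_tensor K M N x y'"
      if "y \<in> carrier N" "y' \<in> carrier N" for y y'
      unfolding pure
      by (rule trans[OF class_eq T.T_add], unfold rel) (use that x in \<open>blast | simp add: e\<close>)+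
    show "pure_tensor K M N x (c \<odot>\<^bsub>N\<^esub> y) = c \<odot>\<^bsub>?T\<^esub> pure_tensor K M N x y"
      if "c \<in> carrier K" "y \<in> carrier N" for c y
      unfolding pure
      by (rule trans[OF class_eq T.T_smult], unfold rel) (use that x in \<open>blast | simp add: e\<close>)+
  qed
qed

lemma pure_tensor_closed:
  "vectorspace K M \<Longrightarrow> vectorspace K N \<Longrightarrow> x \<in> carrier M \<Longrightarrow> y \<in> carrier N \<Longrightarrow>
    pure_tensor K M N x y \<in> carrier (tensor K M N)"
  by (rule linear_map_closed[of K M _ "\<lambda>x. pure_tensor K M N x y"])
    (use bilinear_map_pure_tensor[of K M N] in \<open>auto simp: bilinear_map_def\<close>)

text \<open>Composed with the projection, both maps are linear on the free space. There they agree
  on generators, whose classes are the pure tensors, hence everywhere by induction over finite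
  linear combinations.\<close>

lemma tensor_eqI:
  assumes "vectorspace K M" "vectorspace K N"
    and f: "linear_map K (tensor K M N) W f" and g: "linear_map K (tensor K M N) W g"
    and eq: "\<And>x y. x \<in> carrier M \<Longrightarrow> y \<in> carrier N \<Longrightarrow>
      f (pure_tensor K M N x y) = g (pure_tensor K M N x y)"
    and t: "t \<in> carrier (tensor K M N)"
  shows "f t = g t"
proof -
  let ?F = "free_space K (carrier M \<times> carrier N)"
  let ?q = "\<lambda>u. tensor_kernel K M N +>\<^bsub>?F\<^esub> u"
  have q: "linear_map K ?F (tensor K M N) ?q"
    using assms by (intro linear_map_tensor_class)
  have K: "field K"
    using assms by (simp add: vectorspace_def)
  interpret f: linear_map K ?F W "\<lambda>u. f (?q u)"
    by (rule linear_map_compose[OF q f])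
  interpret g: linear_map K ?F W "\<lambda>u. g (?q u)"
    by (rule linear_map_compose[OF q g])
  obtain u where u: "u \<in> carrier ?F" "t = ?q u"
    using t by (auto simp: tensor_def quotient_space_def A_RCOSETS_def')
  have "f (?q u) = g (?q u)"
    using K u(1)
  proof (induction rule: free_space_induct)
    case zero
    then show ?case using f.T0_is_0 g.T0_is_0 by simp
  next
    case (add c z v)
    have z: "free_gen K z \<in> carrier ?F"
      using K add(2) by (rule free_gen_closed)
    have "f (?q (free_gen K z)) = g (?q (free_gen K z))"
      using add(2) eq by (auto simp: pure_tensor_def)
    with add z show ?case
      by (simp add: f.T_add f.T_smult g.T_add g.T_smult)
  qed
  with u show ?thesis by simp
qed

text \<open>Bilinearity of \<open>b\<close> makes \<open>E\<close> vanish on every relation, hence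
  on the kernel spanned by them. So \<open>E\<close> is constant on each coset, and
  \<open>the_elem\<close> returns its value at any representative.\<close>

lemma tensor_lift:
  assumes "bilinear_map K M N P b"
  shows "linear_map K (tensor K M N) P (tensor_lift K P b)"
    and "x \<in> carrier M \<Longrightarrow> y \<in> carrier N \<Longrightarrow> tensor_lift K P b (pure_tensor K M N x y) = b x y"
proof -
  have M: "vectorspace K M" and N: "vectorspace K N" and P: "vectorspace K P"
    and b1: "\<And>y. y \<in> carrier N \<Longrightarrow> linear_map K M P (\<lambda>x. b x y)"
    and b2: "\<And>x. x \<in> carrier M \<Longrightarrow> linear_map K N P (\<lambda>y. b x y)"
    using assms by (auto simp: bilinear_map_def)
  interpret M: vectorspace K M by fact
  let ?F = "free_space K (carrier M \<times> carrier N)"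
  let ?q = "\<lambda>u. tensor_kernel K M N +>\<^bsub>?F\<^esub> u"
  define E where "E = (\<lambda>f. \<Oplus>\<^bsub>P\<^esub>z\<in>{z. f z \<noteq> \<zero>\<^bsub>K\<^esub>}. f z \<odot>\<^bsub>P\<^esub> b (fst z) (snd z))"
  have b: "b x y \<in> carrier P" if "x \<in> carrier M" "y \<in> carrier N" for x y
    using linear_map_closed[OF b2] that by simp
  then have "b (fst z) (snd z) \<in> carrier P" if "z \<in> carrier M \<times> carrier N" for z
    using that by auto
  note ext = free_space_extension[where g="\<lambda>z. b (fst z) (snd z)", OF P this]
  have E: "linear_map K ?F P E"
    unfolding E_def by (rule ext(1))
  have E_gen: "E (free_gen K (x, y)) = b x y" if "x \<in> carrier M" "y \<in> carrier N" for x y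
    unfolding E_def using ext(2)[where z="(x, y)"] that by simp
  interpret N: vectorspace K N by fact
  interpret F: vectorspace K ?F
    by (rule vectorspace_free_space) (rule M.field_axioms)
  interpret E: linear_map K ?F P E by (rule E)
  interpret q: linear_map K ?F "tensor K M N" ?q
    by (rule linear_map_tensor_class[OF M N])
  have e: "free_gen K (x, y) \<in> carrier ?F" if "x \<in> carrier M" "y \<in> carrier N" for x y
    using that by (simp add: free_gen_closed M.field_axioms)
  have "tensor_relations K M N \<subseteq> E.ker"
    unfolding tensor_relations_def Let_def E.ker_def
    by (auto simp: e E_gen b linear_map_add[OF b1] linear_map_add[OF b2] linear_map_smult[OF b1]
        linear_map_smult[OF b2])
  then have ker: "tensor_kernel K M N \<subseteq> E.ker"
    unfolding tensor_kernel_def by (rule F.span_is_subset[OF _ E.ker_is_submodule])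
  interpret S: submodule K "tensor_kernel K M N" ?F
    using M N by (rule tensor_kernel_submodule)
  have lift: "tensor_lift K P b (?q u) = E u" if u: "u \<in> carrier ?F" for u
  proof -
    have shift: "E (w \<oplus>\<^bsub>?F\<^esub> u) = E u" if "w \<in> tensor_kernel K M N" for w
    proof -
      have "w \<in> carrier ?F" "E w = \<zero>\<^bsub>P\<^esub>"
        using that ker by (auto simp: E.ker_def)
      then show ?thesis using u by (simp add: E.T_im)
    qed
    have "E ` ?q u = (\<lambda>w. E (w \<oplus>\<^bsub>?F\<^esub> u)) ` tensor_kernel K M N"
      by (simp add: a_r_coset_def' UNION_singleton_eq_range image_image)
    also have "\<dots> = (\<lambda>w. E u) ` tensor_kernel K M N"
      by (rule image_cong) (simp_all add: shift)
    \<comment> \<open>The kernel contains zero, so the image under the constant function is not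
      empty.\<close>
    also have "\<dots> = {E u}"
      using S.zero_closed by blast
    finally have "the_elem (E ` ?q u) = E u"
      by simp
    then show ?thesis
      by (simp only: tensor_lift_def E_def)
  qed
  have carr: "carrier (tensor K M N) = ?q ` carrier ?F"
    by (auto simp: tensor_def quotient_space_def A_RCOSETS_def')
  show "linear_map K (tensor K M N) P (tensor_lift K P b)"
  proof (rule linear_mapI[OF q.W.vectorspace_axioms P])
    show "tensor_lift K P b t \<in> carrier P" if "t \<in> carrier (tensor K M N)" for t
      using that by (auto simp: carr lift E.T_im)
    show "tensor_lift K P b (s \<oplus>\<^bsub>tensor K M N\<^esub> t) =
        tensor_lift K P b s \<oplus>\<^bsub>P\<^esub> tensor_lift K P b t"
      if "s \<in> carrier (tensor K M N)" "t \<in> carrier (tensor K M N)" for s t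
      using that by (auto simp: carr lift E.T_add q.T_add[symmetric] simp del: q.f_add)
    show "tensor_lift K P b (c \<odot>\<^bsub>tensor K M N\<^esub> t) = c \<odot>\<^bsub>P\<^esub> tensor_lift K P b t"
      if "c \<in> carrier K" "t \<in> carrier (tensor K M N)" for c t
      using that by (auto simp: carr lift E.T_smult q.T_smult[symmetric] simp del: q.f_smult)
  qed
  show "tensor_lift K P b (pure_tensor K M N x y) = b x y" if "x \<in> carrier M" "y \<in> carrier N"
    using that by (simp add: pure_tensor_def lift e E_gen)
qed

section \<open>Bilinear maps and tensor products of linear maps\<close>

lemma bilinear_map_left: "bilinear_map K M N P b \<Longrightarrow> y \<in> carrier N \<Longrightarrow> linear_map K M P (\<lambda>x. b x y)"
  by (simp add: bilinear_map_def)

lemma bilinear_map_right: "bilinear_map K M N P b \<Longrightarrow> x \<in> carrier M \<Longrightarrow> linear_map K N P (b x)"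
  by (simp add: bilinear_map_def)

lemma bilinear_map_flip: "bilinear_map K M N P b \<Longrightarrow> bilinear_map K N M P (\<lambda>y x. b x y)"
  by (simp add: bilinear_map_def)

lemma bilinear_map_compose:
  assumes "bilinear_map K M' N' P b" and f: "linear_map K M M' f" and g: "linear_map K N N' g"
  shows "bilinear_map K M N P (\<lambda>x y. b (f x) (g y))"
proof (rule bilinear_mapI)
  show "linear_map K M P (\<lambda>x. b (f x) (g y))" if "y \<in> carrier N" for y
    by (rule linear_map_compose[OF f bilinear_map_left[OF assms(1)]])
      (rule linear_map_closed[OF g that])
  show "linear_map K N P (\<lambda>y. b (f x) (g y))" if "x \<in> carrier M" for x
    by (rule linear_map_compose[OF g bilinear_map_right[OF assms(1)]])
      (rule linear_map_closed[OF f that])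
qed (use assms in \<open>auto simp: bilinear_map_def linear_map_domain\<close>)

lemma linear_map_plus:
  assumes f: "linear_map K V W f" and g: "linear_map K V W g"
  shows "linear_map K V W (\<lambda>x. f x \<oplus>\<^bsub>W\<^esub> g x)"
proof -
  interpret W: vectorspace K W by (rule linear_map_codomain[OF f])
  interpret f: linear_map K V W f by fact
  interpret g: linear_map K V W g by fact
  show ?thesis
    by (rule linear_mapI)
      (simp_all add: f.V.vectorspace_axioms W.vectorspace_axioms f.T_im g.T_im
        W.a_ac W.smult_r_distr)
qed

lemma linear_map_scale:
  assumes f: "linear_map K V W f" and c: "c \<in> carrier K"
  shows "linear_map K V W (\<lambda>x. c \<odot>\<^bsub>W\<^esub> f x)"
proof -
  interpret W: vectorspace K W by (rule linear_map_codomain[OF f])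
  interpret f: linear_map K V W f by fact
  \<comment> \<open>Commutativity of the field enters here: two scalings may be
    interchanged.\<close>
  have "c \<odot>\<^bsub>W\<^esub> (d \<odot>\<^bsub>W\<^esub> f x) = d \<odot>\<^bsub>W\<^esub> (c \<odot>\<^bsub>W\<^esub> f x)"
    if "d \<in> carrier K" "x \<in> carrier V" for d x
    using that c by (simp add: f.T_im W.smult_assoc1[symmetric] W.m_comm)
  then show ?thesis
    using c by (intro linear_mapI)
      (simp_all add: f.V.vectorspace_axioms W.vectorspace_axioms f.T_im W.smult_r_distr)
qed

text \<open>Lifts a trilinear map in its first two arguments. Linearity in \<open>z\<close> is not
  visible from the formula of the lift, but both sides of each law are linear in \<open>t\<close>,
  so they need only be compared on pure tensors.\<close>

lemma bilinear_map_tensor_lift: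
  assumes P: "vectorspace K P"
    and b1: "\<And>z. z \<in> carrier P \<Longrightarrow> bilinear_map K M N W (\<lambda>x y. b x y z)"
    and b2: "\<And>x y. x \<in> carrier M \<Longrightarrow> y \<in> carrier N \<Longrightarrow> linear_map K P W (b x y)"
  shows "bilinear_map K (tensor K M N) P W (\<lambda>t z. tensor_lift K W (\<lambda>x y. b x y z) t)"
proof -
  interpret P: vectorspace K P by fact
  have M: "vectorspace K M" and N: "vectorspace K N" and W: "vectorspace K W"
    using b1[OF P.zero_closed] by (auto simp: bilinear_map_def)
  note lift = tensor_lift[OF b1]
  show ?thesis
  proof (rule bilinear_mapI)
    fix t assume t: "t \<in> carrier (tensor K M N)"
    show "linear_map K P W (\<lambda>z. tensor_lift K W (\<lambda>x y. b x y z) t)"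
    proof (rule linear_mapI[OF P W])
      show "tensor_lift K W (\<lambda>x y. b x y z) t \<in> carrier W" if "z \<in> carrier P" for z
        by (rule linear_map_closed[OF lift(1)[OF that] t])
      show "tensor_lift K W (\<lambda>x y. b x y (z \<oplus>\<^bsub>P\<^esub> z')) t =
          tensor_lift K W (\<lambda>x y. b x y z) t \<oplus>\<^bsub>W\<^esub> tensor_lift K W (\<lambda>x y. b x y z') t"
        if "z \<in> carrier P" "z' \<in> carrier P" for z z'
        by (rule tensor_eqI[OF M N lift(1) linear_map_plus[OF lift(1) lift(1)] _ t])
          (use that in \<open>simp_all add: lift(2) linear_map_add[OF b2]\<close>)
      show "tensor_lift K W (\<lambda>x y. b x y (c \<odot>\<^bsub>P\<^esub> z)) t =
          c \<odot>\<^bsub>W\<^esub> tensor_lift K W (\<lambda>x y. b x y z) t"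
        if "c \<in> carrier K" "z \<in> carrier P" for c z
        by (rule tensor_eqI[OF M N lift(1) linear_map_scale[OF lift(1)] _ t])
          (use that in \<open>simp_all add: lift(2) linear_map_smult[OF b2]\<close>)
    qed
  qed (simp_all add: P W vectorspace_tensor M N lift(1))
qed

section \<open>Functoriality of the tensor product\<close>

lemma tensor_map:
  assumes f: "linear_map K M M' f" and g: "linear_map K N N' g"
  shows linear_map_tensor_map: "linear_map K (tensor K M N) (tensor K M' N') (tensor_map K M' N' f g)"
    and tensor_map_pure: "x \<in> carrier M \<Longrightarrow> y \<in> carrier N \<Longrightarrow>
      tensor_map K M' N' f g (pure_tensor K M N x y) = pure_tensor K M' N' (f x) (g y)"
proof -
  have "bilinear_map K M N (tensor K M' N') (\<lambda>x y. pure_tensor K M' N' (f x) (g y))"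
    by (rule bilinear_map_compose[OF bilinear_map_pure_tensor f g])
      (rule linear_map_codomain[OF f] linear_map_codomain[OF g])+
  note lift = tensor_lift[OF this, folded tensor_map_def]
  show "linear_map K (tensor K M N) (tensor K M' N') (tensor_map K M' N' f g)"
    by (rule lift(1))
  show "tensor_map K M' N' f g (pure_tensor K M N x y) = pure_tensor K M' N' (f x) (g y)"
    if "x \<in> carrier M" "y \<in> carrier N"
    using that by (rule lift(2))
qed

lemma tensor_map_compose:
  assumes f: "linear_map K M M' f" and g: "linear_map K N N' g"
    and f': "linear_map K M' M'' f'" and g': "linear_map K N' N'' g'"
    and t: "t \<in> carrier (tensor K M N)"
  shows "tensor_map K M'' N'' f' g' (tensor_map K M' N' f g t) =
    tensor_map K M'' N'' (\<lambda>x. f' (f x)) (\<lambda>y. g' (g y)) t"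
  by (rule tensor_eqI[OF linear_map_domain[OF f] linear_map_domain[OF g]
        linear_map_compose[OF linear_map_tensor_map[OF f g] linear_map_tensor_map[OF f' g']]
        linear_map_tensor_map[OF linear_map_compose[OF f f'] linear_map_compose[OF g g']] _ t])
    (simp add: tensor_map_pure[OF f g] tensor_map_pure[OF f' g'] linear_map_closed[OF f]
      linear_map_closed[OF g] tensor_map_pure[OF linear_map_compose[OF f f'] linear_map_compose[OF g g']])

text \<open>Linear maps are total functions with arbitrary values outside the carrier, so maps that
  agree on the carrier need not be equal and cannot simply be rewritten into each other.\<close>

lemma tensor_map_cong:
  assumes f: "linear_map K M M' f" and g: "linear_map K N N' g"
    and f': "linear_map K M M' f'" and g': "linear_map K N N' g'"
    and "\<And>x. x \<in> carrier M \<Longrightarrow> f x = f' x" and "\<And>y. y \<in> carrier N \<Longrightarrow> g y = g' y"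
    and t: "t \<in> carrier (tensor K M N)"
  shows "tensor_map K M' N' f g t = tensor_map K M' N' f' g' t"
  by (rule tensor_eqI[OF linear_map_domain[OF f] linear_map_domain[OF g]
        linear_map_tensor_map[OF f g] linear_map_tensor_map[OF f' g'] _ t])
    (simp add: tensor_map_pure[OF f g] tensor_map_pure[OF f' g'] assms)

section \<open>Associativity of triple tensor products\<close>

context
  fixes K :: "'k ring" and M :: "('k, 'a) module" and N :: "('k, 'b) module"
    and P :: "('k, 'c) module"
  assumes vs: "vectorspace K M" "vectorspace K N" "vectorspace K P"
begin

text \<open>The definition nests two lifts. \<open>bilinear_map_tensor_lift\<close> makes the inner
  one, which has \<open>z\<close> as parameter, bilinear in its tensor and \<open>z\<close>, as the
  outer lift requires.\<close>

lemma tensor_assoc: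
  shows linear_map_tensor_assoc: "linear_map K (tensor K (tensor K M N) P)
      (tensor K M (tensor K N P)) (tensor_assoc K M N P)"
    and tensor_assoc_pure: "x \<in> carrier M \<Longrightarrow> y \<in> carrier N \<Longrightarrow> z \<in> carrier P \<Longrightarrow>
      tensor_assoc K M N P (pure_tensor K (tensor K M N) P (pure_tensor K M N x y) z) =
      pure_tensor K M (tensor K N P) x (pure_tensor K N P y z)"
proof -
  let ?T = "tensor K M (tensor K N P)"
  note NP = vectorspace_tensor[OF vs(2,3)]
  note pure = bilinear_map_pure_tensor[OF vs(1) NP]
  let ?b = "\<lambda>x y z. pure_tensor K M (tensor K N P) x (pure_tensor K N P y z)"
  have b1: "bilinear_map K M N ?T (\<lambda>x y. ?b x y z)" if "z \<in> carrier P" for z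
    by (rule bilinear_map_compose[OF pure linear_map_id[OF vs(1)]
          bilinear_map_left[OF bilinear_map_pure_tensor[OF vs(2,3)] that]])
  have b2: "linear_map K P ?T (?b x y)" if "x \<in> carrier M" "y \<in> carrier N" for x y
    by (rule linear_map_compose[OF bilinear_map_right[OF bilinear_map_pure_tensor[OF vs(2,3)]]
          bilinear_map_right[OF pure]]) (use that in simp_all)
  note lift = tensor_lift[OF bilinear_map_tensor_lift[where b="?b", OF vs(3) b1 b2]]
  show "linear_map K (tensor K (tensor K M N) P) ?T (tensor_assoc K M N P)"
    unfolding tensor_assoc_def Let_def by (rule lift(1))
  show "tensor_assoc K M N P (pure_tensor K (tensor K M N) P (pure_tensor K M N x y) z) = ?b x y z"
    if "x \<in> carrier M" "y \<in> carrier N" "z \<in> carrier P"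
    unfolding tensor_assoc_def Let_def
    by (simp add: lift(2) that pure_tensor_closed vs tensor_lift(2)[OF b1])
qed

lemma tensor_unassoc:
  shows linear_map_tensor_unassoc: "linear_map K (tensor K M (tensor K N P))
      (tensor K (tensor K M N) P) (tensor_unassoc K M N P)"
    and tensor_unassoc_pure: "x \<in> carrier M \<Longrightarrow> y \<in> carrier N \<Longrightarrow> z \<in> carrier P \<Longrightarrow>
      tensor_unassoc K M N P (pure_tensor K M (tensor K N P) x (pure_tensor K N P y z)) =
      pure_tensor K (tensor K M N) P (pure_tensor K M N x y) z"
proof -
  let ?T = "tensor K (tensor K M N) P"
  note MN = vectorspace_tensor[OF vs(1,2)]
  note pure = bilinear_map_pure_tensor[OF MN vs(3)]
  \<comment> \<open>The parameter \<open>x\<close> comes last, as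
    \<open>bilinear_map_tensor_lift\<close> expects; \<open>bilinear_map_flip\<close> then restores
    the order of arguments in \<open>tensor_unassoc\<close>.\<close>
  let ?b = "\<lambda>y z x. pure_tensor K (tensor K M N) P (pure_tensor K M N x y) z"
  have b1: "bilinear_map K N P ?T (\<lambda>y z. ?b y z x)" if "x \<in> carrier M" for x
    by (rule bilinear_map_compose[OF pure
          bilinear_map_right[OF bilinear_map_pure_tensor[OF vs(1,2)] that] linear_map_id[OF vs(3)]])
  have b2: "linear_map K M ?T (?b y z)" if "y \<in> carrier N" "z \<in> carrier P" for y z
    by (rule linear_map_compose[OF bilinear_map_left[OF bilinear_map_pure_tensor[OF vs(1,2)]]
          bilinear_map_left[OF pure]]) (use that in simp_all)
  note lift = tensor_lift[OF bilinear_map_flip[OF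
      bilinear_map_tensor_lift[where b="?b", OF vs(1) b1 b2]]]
  show "linear_map K (tensor K M (tensor K N P)) ?T (tensor_unassoc K M N P)"
    unfolding tensor_unassoc_def Let_def by (rule lift(1))
  show "tensor_unassoc K M N P (pure_tensor K M (tensor K N P) x (pure_tensor K N P y z)) = ?b y z x"
    if "x \<in> carrier M" "y \<in> carrier N" "z \<in> carrier P"
    unfolding tensor_unassoc_def Let_def
    by (simp add: lift(2) that pure_tensor_closed vs tensor_lift(2)[OF b1])
qed

lemma tensor_eqI_triple:
  assumes f: "linear_map K (tensor K (tensor K M N) P) W f"
    and g: "linear_map K (tensor K (tensor K M N) P) W g"
    and eq: "\<And>x y z. x \<in> carrier M \<Longrightarrow> y \<in> carrier N \<Longrightarrow> z \<in> carrier P \<Longrightarrow>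
      f (pure_tensor K (tensor K M N) P (pure_tensor K M N x y) z) =
      g (pure_tensor K (tensor K M N) P (pure_tensor K M N x y) z)"
    and t: "t \<in> carrier (tensor K (tensor K M N) P)"
  shows "f t = g t"
proof (rule tensor_eqI[OF vectorspace_tensor[OF vs(1,2)] vs(3) f g _ t])
  fix s z assume s: "s \<in> carrier (tensor K M N)" and z: "z \<in> carrier P"
  note pure = bilinear_map_left[OF bilinear_map_pure_tensor[OF vectorspace_tensor[OF vs(1,2)] vs(3)] z]
  show "f (pure_tensor K (tensor K M N) P s z) = g (pure_tensor K (tensor K M N) P s z)"
    by (rule tensor_eqI[OF vs(1,2) linear_map_compose[OF pure f] linear_map_compose[OF pure g] _ s])
      (rule eq[OF _ _ z])
qed

text \<open>Coassociativity equates right-nested tensors, while the function \<open>L\<close> in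
  \<open>R_mult_A\<close> lives on left-nested ones; this identity carries it over.\<close>

lemma tensor_unassoc_assoc:
  assumes "t \<in> carrier (tensor K (tensor K M N) P)"
  shows "tensor_unassoc K M N P (tensor_assoc K M N P t) = t"
  by (rule tensor_eqI_triple[OF linear_map_compose[OF linear_map_tensor_assoc
          linear_map_tensor_unassoc] linear_map_id _ assms])
    (simp_all add: tensor_assoc_pure tensor_unassoc_pure vectorspace_tensor vs)

end

section \<open>Endomorphisms of BiHom-bialgebras\<close>

text \<open>One argument for both signs of the exponent: every integer power is an iterate of
  \<open>f\<close> or of its inverse.\<close>

lemma int_power_induct:
  assumes "P (\<lambda>x. x)" and "\<And>g h. P g \<Longrightarrow> P h \<Longrightarrow> P (\<lambda>x. g (h x))"
    and "P f" and "P (inv_map V f)"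
  shows "P (int_power V f k)"
proof -
  have "P (g ^^ i)" if "P g" for g i
    using assms(1,2) that by (induction i) (auto simp: id_def o_def)
  with assms(3,4) show ?thesis
    by (simp add: int_power_def)
qed

context bihom_bialgebra
begin

text \<open>Chosen to contain the four structure maps and to be closed under composition and
  inverses of bijections, so that it also contains their integer powers when they are
  bijective.\<close>

definition bialgebra_end :: "('h \<Rightarrow> 'h) \<Rightarrow> bool" where
  "bialgebra_end f \<longleftrightarrow> linear_map K H H f \<and>
    (\<forall>x\<in>carrier H. \<forall>y\<in>carrier H.
      f (\<mu> (pure_tensor K H H x y)) = \<mu> (pure_tensor K H H (f x) (f y))) \<and>
    (\<forall>x\<in>carrier H. tensor_map K H H f f (\<Delta> x) = \<Delta> (f x)) \<and>
    (\<forall>x\<in>carrier H. f (\<alpha> x) = \<alpha> (f x) \<and> f (\<beta> x) = \<beta> (f x) \<and> f (\<psi> x) = \<psi> (f x) \<and>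
      f (\<omega> x) = \<omega> (f x))"

lemma bialgebra_endD:
  assumes "bialgebra_end f"
  shows "linear_map K H H f"
    and "x \<in> carrier H \<Longrightarrow> f x \<in> carrier H"
    and "x \<in> carrier H \<Longrightarrow> y \<in> carrier H \<Longrightarrow>
      f (\<mu> (pure_tensor K H H x y)) = \<mu> (pure_tensor K H H (f x) (f y))"
    and "x \<in> carrier H \<Longrightarrow> \<Delta> (f x) = tensor_map K H H f f (\<Delta> x)"
    and "x \<in> carrier H \<Longrightarrow> f (\<alpha> x) = \<alpha> (f x)"
    and "x \<in> carrier H \<Longrightarrow> f (\<beta> x) = \<beta> (f x)"
    and "x \<in> carrier H \<Longrightarrow> f (\<psi> x) = \<psi> (f x)"
    and "x \<in> carrier H \<Longrightarrow> f (\<omega> x) = \<omega> (f x)"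
  using assms by (auto simp: bialgebra_end_def intro: linear_map_closed)

lemma vectorspace_H: "vectorspace K H"
  by (rule linear_map_domain[OF alpha_linear])

lemma mult_closed: "x \<in> carrier H \<Longrightarrow> y \<in> carrier H \<Longrightarrow> \<mu> (pure_tensor K H H x y) \<in> carrier H"
  by (rule linear_map_closed[OF mult_linear]) (simp add: pure_tensor_closed vectorspace_H)

lemma comult_closed: "x \<in> carrier H \<Longrightarrow> \<Delta> x \<in> carrier (tensor K H H)"
  by (rule linear_map_closed[OF comult_linear])

lemma bialgebra_end_structure_maps:
  "bialgebra_end \<alpha>" "bialgebra_end \<beta>" "bialgebra_end \<psi>" "bialgebra_end \<omega>"
  unfolding bialgebra_end_def
  by (simp_all add: alpha_linear beta_linear psi_linear omega_linear alpha_mult beta_mult psi_mult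
      omega_mult alpha_comult beta_comult psi_comult omega_comult alpha_beta alpha_psi alpha_omega
      beta_psi beta_omega psi_omega)

lemma tensor_map_id: "t \<in> carrier (tensor K H H) \<Longrightarrow> tensor_map K H H (\<lambda>x. x) (\<lambda>x. x) t = t"
  by (rule tensor_eqI[OF vectorspace_H vectorspace_H linear_map_tensor_map linear_map_id])
    (simp_all add: vectorspace_H linear_map_id tensor_map_pure vectorspace_tensor)

lemma bialgebra_end_id: "bialgebra_end (\<lambda>x. x)"
  by (simp add: bialgebra_end_def linear_map_id vectorspace_H tensor_map_id comult_closed)

lemma bialgebra_end_compose:
  assumes f: "bialgebra_end f" and g: "bialgebra_end g"
  shows "bialgebra_end (\<lambda>x. f (g x))"
proof -
  note fD = bialgebra_endD[OF f] and gD = bialgebra_endD[OF g]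
  have "tensor_map K H H (\<lambda>x. f (g x)) (\<lambda>x. f (g x)) (\<Delta> x) = \<Delta> (f (g x))" if "x \<in> carrier H" for x
    using that
    by (simp add: fD gD tensor_map_compose[OF gD(1) gD(1) fD(1) fD(1)] comult_closed)
  then show ?thesis
    by (simp add: bialgebra_end_def fD gD linear_map_compose[OF gD(1) fD(1)] mult_closed)
qed

lemma inv_map_cancel:
  assumes "bij_map H f" "x \<in> carrier H"
  shows "inv_map H f (f x) = x" and "f (inv_map H f x) = x" and "inv_map H f x \<in> carrier H"
  using assms by (simp_all add: bij_betw_inv_into_left bij_betw_inv_into_right
      bij_betw_apply[OF bij_betw_inv_into])

lemma inv_map_commute:
  assumes "bij_map H f" and "\<And>x. x \<in> carrier H \<Longrightarrow> g x \<in> carrier H"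
    and "\<And>x. x \<in> carrier H \<Longrightarrow> g (f x) = f (g x)" and "x \<in> carrier H"
  shows "g (inv_map H f x) = inv_map H f (g x)"
  using assms inv_map_cancel[OF assms(1)] by metis

lemma bialgebra_end_inv_map:
  assumes f: "bialgebra_end f" and bij: "bij_map H f"
  shows "bialgebra_end (inv_map H f)"
proof -
  note fD = bialgebra_endD[OF f]
  let ?g = "inv_map H f"
  note inv = inv_map_cancel[OF bij]
  have lin: "linear_map K H H ?g"
    by (rule linear_map_inv_into[OF fD(1) bij])
  \<comment> \<open>Apply \<open>?g\<close> to \<open>f\<close> of the right-hand side, which is the
    product of \<open>x\<close> and \<open>y\<close>.\<close>
  have mult: "?g (\<mu> (pure_tensor K H H x y)) = \<mu> (pure_tensor K H H (?g x) (?g y))"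
    if "x \<in> carrier H" "y \<in> carrier H" for x y
    using inv(1)[of "\<mu> (pure_tensor K H H (?g x) (?g y))"] that by (simp add: fD inv mult_closed)
  have comult: "tensor_map K H H ?g ?g (\<Delta> x) = \<Delta> (?g x)" if x: "x \<in> carrier H" for x
  proof -
    \<comment> \<open>Inserting \<open>?g\<close> after \<open>f\<close> on both legs changes
      nothing. Comultiplicativity of \<open>f\<close> at \<open>?g x\<close> then absorbs the copies
      of \<open>f\<close> and leaves \<open>\<Delta> x\<close> with \<open>?g\<close> on both
      legs.\<close>
    have "\<Delta> (?g x) = tensor_map K H H (\<lambda>x. ?g (f x)) (\<lambda>x. ?g (f x)) (\<Delta> (?g x))"
      using x
      by (subst tensor_map_cong[where f'="\<lambda>x. x" and g'="\<lambda>x. x", OF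
            linear_map_compose[OF fD(1) lin] linear_map_compose[OF fD(1) lin]
            linear_map_id[OF vectorspace_H] linear_map_id[OF vectorspace_H]])
        (simp_all add: inv comult_closed tensor_map_id)
    also have "\<dots> = tensor_map K H H ?g ?g (tensor_map K H H f f (\<Delta> (?g x)))"
      using x
      by (intro tensor_map_compose[symmetric, OF fD(1) fD(1) lin lin] comult_closed inv(3))
    also have "\<dots> = tensor_map K H H ?g ?g (\<Delta> (f (?g x)))"
      using x by (simp add: fD(4) inv(3) del: inv(2))
    finally show ?thesis
      using x by (simp add: inv)
  qed
  have comm: "?g (k x) = k (?g x)" if "bialgebra_end k" "\<And>x. x \<in> carrier H \<Longrightarrow> f (k x) = k (f x)"
    "x \<in> carrier H" for k x
    using inv_map_commute[OF bij, of k x] bialgebra_endD[OF that(1)] that by simp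
  show ?thesis
    unfolding bialgebra_end_def
    by (simp add: lin mult comult comm[OF bialgebra_end_structure_maps(1) fD(5)]
        comm[OF bialgebra_end_structure_maps(2) fD(6)] comm[OF bialgebra_end_structure_maps(3) fD(7)]
        comm[OF bialgebra_end_structure_maps(4) fD(8)])
qed

lemma bialgebra_end_int_power:
  assumes "bialgebra_end f" and "bij_map H f"
  shows "bialgebra_end (int_power H f k)"
  by (rule int_power_induct)
    (use assms in \<open>auto intro: bialgebra_end_id bialgebra_end_compose bialgebra_end_inv_map\<close>)

end

section \<open>The twisting map\<close>

locale twisting_data =
  left_module_bihom_algebra K H \<mu>\<^sub>H \<Delta>\<^sub>H \<alpha>\<^sub>H \<beta>\<^sub>H \<psi>\<^sub>H \<omega>\<^sub>H A \<mu>\<^sub>A \<alpha>\<^sub>A \<beta>\<^sub>A act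
  for K :: "'k ring" and H :: "('k, 'h) module"
    and \<mu>\<^sub>H :: "('h \<times> 'h \<Rightarrow> 'k) set \<Rightarrow> 'h" and \<Delta>\<^sub>H :: "'h \<Rightarrow> ('h \<times> 'h \<Rightarrow> 'k) set"
    and \<alpha>\<^sub>H \<beta>\<^sub>H \<psi>\<^sub>H \<omega>\<^sub>H :: "'h \<Rightarrow> 'h"
    and A :: "('k, 'a) module" and \<mu>\<^sub>A :: "('a \<times> 'a \<Rightarrow> 'k) set \<Rightarrow> 'a" and \<alpha>\<^sub>A \<beta>\<^sub>A :: "'a \<Rightarrow> 'a"
    and act :: "('h \<times> 'a \<Rightarrow> 'k) set \<Rightarrow> 'a" +
  fixes m n p :: int
  assumes bij_A: "bij_map A \<alpha>\<^sub>A" "bij_map A \<beta>\<^sub>A"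
begin

abbreviation "HH \<equiv> tensor K H H"
abbreviation "AH \<equiv> tensor K A H"
abbreviation "HA \<equiv> tensor K H A"
abbreviation "AA \<equiv> tensor K A A"

abbreviation mult_H (infixl \<open>\<star>\<close> 70) where "x \<star> y \<equiv> \<mu>\<^sub>H (pure_tensor K H H x y)"
abbreviation mult_A (infixl \<open>\<diamondop>\<close> 70) where "a \<diamondop> b \<equiv> \<mu>\<^sub>A (pure_tensor K A A a b)"
abbreviation action (infixr \<open>\<rightharpoonup>\<close> 75) where "h \<rightharpoonup> a \<equiv> act (pure_tensor K H A h a)"

abbreviation "\<alpha>\<^sub>H' \<equiv> inv_map H \<alpha>\<^sub>H"
abbreviation "\<beta>\<^sub>H' \<equiv> inv_map H \<beta>\<^sub>H"
abbreviation "\<psi>\<^sub>H' \<equiv> inv_map H \<psi>\<^sub>H"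
abbreviation "\<omega>\<^sub>H' \<equiv> inv_map H \<omega>\<^sub>H"
abbreviation "\<alpha>\<^sub>A' \<equiv> inv_map A \<alpha>\<^sub>A"
abbreviation "\<beta>\<^sub>A' \<equiv> inv_map A \<beta>\<^sub>A"

definition \<Phi> :: "'h \<Rightarrow> 'h" where
  "\<Phi> = (\<lambda>h. int_power H \<alpha>\<^sub>H m (int_power H \<beta>\<^sub>H n (int_power H \<omega>\<^sub>H p h)))"

text \<open>The algebra element comes first, so that \<open>twisted_action a\<close> is the map that
  \<open>R\<close> applies to the first leg of \<open>\<Delta>\<^sub>H h\<close>.\<close>

definition twisted_action :: "'a \<Rightarrow> 'h \<Rightarrow> 'a" where
  "twisted_action a = (\<lambda>h. \<Phi> h \<rightharpoonup> \<beta>\<^sub>A' a)"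

abbreviation R :: "('h \<times> 'a \<Rightarrow> 'k) set \<Rightarrow> ('a \<times> 'h \<Rightarrow> 'k) set" where
  "R \<equiv> R_map K H \<Delta>\<^sub>H \<alpha>\<^sub>H \<beta>\<^sub>H \<psi>\<^sub>H \<omega>\<^sub>H A \<beta>\<^sub>A act m n p"

lemma \<Phi>_end: "H.bialgebra_end \<Phi>"
  unfolding \<Phi>_def
  by (rule H.bialgebra_end_compose[OF _ H.bialgebra_end_compose];
      intro H.bialgebra_end_int_power H.bialgebra_end_structure_maps bij_H)

lemma \<psi>'_end: "H.bialgebra_end \<psi>\<^sub>H'"
  by (intro H.bialgebra_end_inv_map H.bialgebra_end_structure_maps bij_H)

lemma \<beta>'_end: "H.bialgebra_end \<beta>\<^sub>H'"
  by (intro H.bialgebra_end_inv_map H.bialgebra_end_structure_maps bij_H)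

lemmas vs_H = H.vectorspace_H

lemma vs_A: "vectorspace K A"
  by (rule linear_map_domain[OF alpha_linear])

lemmas vs = vs_H vs_A vectorspace_tensor

lemma inv_linear:
  "linear_map K H H \<alpha>\<^sub>H'" "linear_map K H H \<beta>\<^sub>H'" "linear_map K H H \<psi>\<^sub>H'" "linear_map K H H \<omega>\<^sub>H'"
  "linear_map K A A \<alpha>\<^sub>A'" "linear_map K A A \<beta>\<^sub>A'"
  by (rule linear_map_inv_into; simp add: H.alpha_linear H.beta_linear H.psi_linear H.omega_linear
      A.alpha_linear A.beta_linear bij_H bij_A)+

lemmas basic_linear =
  H.alpha_linear H.beta_linear H.psi_linear H.omega_linear H.mult_linear H.comult_linear
  A.alpha_linear A.beta_linear A.mult_linear act_linear inv_linear \<Phi>_end[THEN H.bialgebra_endD(1)]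

text \<open>
  To be applied with \<open>rule\<close>: \<open>intro\<close> does not instantiate the intermediate spaces, which become
  known only at the innermost map.
\<close>

lemmas linear_intros =
  linear_map_id basic_linear[THEN linear_map_compose[rotated]]
  linear_map_compose[OF _ bilinear_map_left[OF bilinear_map_pure_tensor]]
  linear_map_compose[OF _ bilinear_map_right[OF bilinear_map_pure_tensor]]
  linear_map_compose[OF _ linear_map_tensor_map]
  linear_map_compose[OF _ linear_map_tensor_assoc]
  linear_map_compose[OF _ linear_map_tensor_unassoc]

lemma closed:
  "x \<in> carrier H \<Longrightarrow> y \<in> carrier H \<Longrightarrow> x \<star> y \<in> carrier H"
  "a \<in> carrier A \<Longrightarrow> b \<in> carrier A \<Longrightarrow> a \<diamondop> b \<in> carrier A"
  "x \<in> carrier H \<Longrightarrow> a \<in> carrier A \<Longrightarrow> x \<rightharpoonup> a \<in> carrier A"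
  by (simp_all add: linear_map_closed[OF H.mult_linear] linear_map_closed[OF A.mult_linear]
      linear_map_closed[OF act_linear] pure_tensor_closed vs)

lemmas closures = closed basic_linear[THEN linear_map_closed] pure_tensor_closed[OF vs_H vs_H]
  pure_tensor_closed[OF vs_A vs_A] pure_tensor_closed[OF vs_A vs_H]

section \<open>\<open>R\<close> as a well-defined linear map\<close>

lemma twisted_action_linear:
  "a \<in> carrier A \<Longrightarrow> linear_map K H A (twisted_action a)"
  "h \<in> carrier H \<Longrightarrow> linear_map K A A (\<lambda>a. twisted_action a h)"
  unfolding twisted_action_def by (rule linear_intros | simp add: vs closures)+

lemma twisted_action_closed:
  "a \<in> carrier A \<Longrightarrow> h \<in> carrier H \<Longrightarrow> twisted_action a h \<in> carrier A"
  by (simp add: twisted_action_def closures)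

text \<open>Since \<open>a\<close> occurs inside one of the tensored maps, linearity in
  \<open>a\<close> is not a matter of composition. With an arbitrary \<open>t\<close> in place of
  \<open>\<Delta>\<^sub>H h\<close>, the expression is a lift with parameter \<open>a\<close>;
  composing with \<open>\<Delta>\<^sub>H\<close> gives the claim.\<close>

lemma R_bilinear:
  "bilinear_map K H A AH (\<lambda>h a. tensor_map K A H (twisted_action a) \<psi>\<^sub>H' (\<Delta>\<^sub>H h))"
proof -
  have "bilinear_map K HH A AH
      (\<lambda>t a. tensor_lift K AH (\<lambda>x y. pure_tensor K A H (twisted_action a x) (\<psi>\<^sub>H' y)) t)"
  proof (rule bilinear_map_tensor_lift[OF vs_A])
    show "bilinear_map K H H AH (\<lambda>x y. pure_tensor K A H (twisted_action a x) (\<psi>\<^sub>H' y))"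
      if "a \<in> carrier A" for a
      by (rule bilinear_map_compose[OF bilinear_map_pure_tensor[OF vs_A vs_H]
            twisted_action_linear(1)[OF that] inv_linear(3)])
    show "linear_map K A AH (\<lambda>a. pure_tensor K A H (twisted_action a x) (\<psi>\<^sub>H' y))"
      if "x \<in> carrier H" "y \<in> carrier H" for x y
      by (rule linear_map_compose[OF twisted_action_linear(2)
            bilinear_map_left[OF bilinear_map_pure_tensor]])
        (use that in \<open>simp_all add: vs closures\<close>)
  qed
  from bilinear_map_compose[OF this H.comult_linear linear_map_id[OF vs_A]] show ?thesis
    by (simp add: tensor_map_def)
qed

lemma R_eq: "R = tensor_lift K AH (\<lambda>h a. tensor_map K A H (twisted_action a) \<psi>\<^sub>H' (\<Delta>\<^sub>H h))"
  by (simp add: R_map_def twisted_action_def \<Phi>_def)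

lemma R_linear: "linear_map K HA AH R"
  unfolding R_eq by (rule tensor_lift(1)[OF R_bilinear])

lemma R_pure: "h \<in> carrier H \<Longrightarrow> a \<in> carrier A \<Longrightarrow>
    R (pure_tensor K H A h a) = tensor_map K A H (twisted_action a) \<psi>\<^sub>H' (\<Delta>\<^sub>H h)"
  unfolding R_eq by (rule tensor_lift(2)[OF R_bilinear])


lemmas R_linear_intros = linear_intros R_linear[THEN linear_map_compose[rotated]]
  twisted_action_linear(1)[THEN linear_map_compose[rotated]]

lemma comp_linear:
  "linear_map K H H (\<lambda>x. \<alpha>\<^sub>H (\<beta>\<^sub>H' x))" "linear_map K A A (\<lambda>x. \<alpha>\<^sub>A' (\<beta>\<^sub>A x))"
  by (rule linear_intros | simp add: vs)+

text \<open>
  As rewrite rules these move the structure maps of \<open>H\<close> outwards past \<open>\<Phi>\<close> into a fixed order in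
  which each map stands next to its inverse.
\<close>

lemma H_commute:
  assumes x: "x \<in> carrier H"
  shows "\<Phi> (\<alpha>\<^sub>H x) = \<alpha>\<^sub>H (\<Phi> x)" "\<Phi> (\<beta>\<^sub>H x) = \<beta>\<^sub>H (\<Phi> x)" "\<Phi> (\<omega>\<^sub>H x) = \<omega>\<^sub>H (\<Phi> x)"
    "\<Phi> (\<beta>\<^sub>H' x) = \<beta>\<^sub>H' (\<Phi> x)" "\<Phi> (\<psi>\<^sub>H' x) = \<psi>\<^sub>H' (\<Phi> x)" "\<alpha>\<^sub>H (\<omega>\<^sub>H x) = \<omega>\<^sub>H (\<alpha>\<^sub>H x)"
    "\<alpha>\<^sub>H (\<beta>\<^sub>H' x) = \<beta>\<^sub>H' (\<alpha>\<^sub>H x)" "\<alpha>\<^sub>H (\<psi>\<^sub>H' x) = \<psi>\<^sub>H' (\<alpha>\<^sub>H x)" "\<beta>\<^sub>H (\<psi>\<^sub>H' x) = \<psi>\<^sub>H' (\<beta>\<^sub>H x)"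
    "\<beta>\<^sub>H' (\<psi>\<^sub>H' x) = \<psi>\<^sub>H' (\<beta>\<^sub>H' x)"
    "\<omega>\<^sub>H' (\<omega>\<^sub>H x) = x" "\<alpha>\<^sub>H' (\<alpha>\<^sub>H x) = x" "\<beta>\<^sub>H (\<beta>\<^sub>H' x) = x" "\<psi>\<^sub>H' (\<psi>\<^sub>H x) = x"
proof -
  note \<Phi> = H.bialgebra_endD[OF \<Phi>_end] and \<psi>' = H.bialgebra_endD[OF \<psi>'_end]
    and \<beta>' = H.bialgebra_endD[OF \<beta>'_end]
  show "\<Phi> (\<alpha>\<^sub>H x) = \<alpha>\<^sub>H (\<Phi> x)" "\<Phi> (\<beta>\<^sub>H x) = \<beta>\<^sub>H (\<Phi> x)" "\<Phi> (\<omega>\<^sub>H x) = \<omega>\<^sub>H (\<Phi> x)"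
    "\<alpha>\<^sub>H (\<omega>\<^sub>H x) = \<omega>\<^sub>H (\<alpha>\<^sub>H x)" "\<alpha>\<^sub>H (\<beta>\<^sub>H' x) = \<beta>\<^sub>H' (\<alpha>\<^sub>H x)" "\<alpha>\<^sub>H (\<psi>\<^sub>H' x) = \<psi>\<^sub>H' (\<alpha>\<^sub>H x)"
    "\<beta>\<^sub>H (\<psi>\<^sub>H' x) = \<psi>\<^sub>H' (\<beta>\<^sub>H x)"
    using x by (simp_all add: \<Phi> \<psi>' \<beta>' H.alpha_omega)
  show "\<Phi> (\<beta>\<^sub>H' x) = \<beta>\<^sub>H' (\<Phi> x)"
    by (rule H.inv_map_commute[where g=\<Phi>, OF bij_H(2) \<Phi>(2) \<Phi>(6) x])
  show "\<Phi> (\<psi>\<^sub>H' x) = \<psi>\<^sub>H' (\<Phi> x)"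
    by (rule H.inv_map_commute[where g=\<Phi>, OF bij_H(3) \<Phi>(2) \<Phi>(7) x])
  show "\<beta>\<^sub>H' (\<psi>\<^sub>H' x) = \<psi>\<^sub>H' (\<beta>\<^sub>H' x)"
    by (rule H.inv_map_commute[where g="\<beta>\<^sub>H'", OF bij_H(3) \<beta>'(2) \<beta>'(7) x])
qed (simp_all add: H.inv_map_cancel bij_H x)

lemma A_commute:
  assumes a: "a \<in> carrier A"
  shows "\<beta>\<^sub>A' (\<beta>\<^sub>A a) = a" "\<beta>\<^sub>A (\<beta>\<^sub>A' a) = a" "\<alpha>\<^sub>A (\<alpha>\<^sub>A' a) = a" "\<beta>\<^sub>A' (\<alpha>\<^sub>A a) = \<alpha>\<^sub>A (\<beta>\<^sub>A' a)"
    and "b \<in> carrier A \<Longrightarrow> \<beta>\<^sub>A' (a \<diamondop> b) = \<beta>\<^sub>A' a \<diamondop> \<beta>\<^sub>A' b"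
proof -
  have inv: "\<beta>\<^sub>A' (\<beta>\<^sub>A a) = a" "\<beta>\<^sub>A (\<beta>\<^sub>A' a) = a" "\<alpha>\<^sub>A (\<alpha>\<^sub>A' a) = a" if "a \<in> carrier A" for a
    using bij_A that by (simp_all add: bij_betw_inv_into_left bij_betw_inv_into_right)
  show "\<beta>\<^sub>A' (\<alpha>\<^sub>A a) = \<alpha>\<^sub>A (\<beta>\<^sub>A' a)"
    using inv(1)[of "\<alpha>\<^sub>A (\<beta>\<^sub>A' a)"] a by (simp add: closures inv(2) A.alpha_beta[symmetric])
  show "\<beta>\<^sub>A' (a \<diamondop> b) = \<beta>\<^sub>A' a \<diamondop> \<beta>\<^sub>A' b" if "b \<in> carrier A"
    using inv(1)[of "\<beta>\<^sub>A' a \<diamondop> \<beta>\<^sub>A' b"] a that by (simp add: closures inv(2) A.beta_mult)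
qed (use a bij_A in \<open>simp_all add: bij_betw_inv_into_left bij_betw_inv_into_right\<close>)

lemmas tensor_simps = tensor_map_pure tensor_assoc_pure tensor_unassoc_pure R_pure linear_map_id
  linear_map_tensor_map basic_linear R_linear comp_linear vs twisted_action_linear(1)

section \<open>Compatibility of \<open>R\<close> with the structure maps\<close>

text \<open>Serves both twisting conditions on structure maps, with \<open>f\<close> acting on
  \<open>H\<close> and \<open>k\<close> on \<open>A\<close>. On the first leg \<open>fk\<close>,
  \<open>f\<Phi>\<close> and \<open>k\<beta>\<close> carry \<open>k\<close> through the action, on
  the second \<open>f\<close> commutes with \<open>\<psi>\<^sub>H'\<close>; comultiplicativity then
  moves \<open>f\<close> from the legs to \<open>h\<close>.\<close>

lemma R_natural:
  assumes f: "H.bialgebra_end f" and k: "linear_map K A A k"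
    and k\<beta>: "\<And>a. a \<in> carrier A \<Longrightarrow> \<beta>\<^sub>A' (k a) = k (\<beta>\<^sub>A' a)"
    and fk: "\<And>h a. h \<in> carrier H \<Longrightarrow> a \<in> carrier A \<Longrightarrow> k (h \<rightharpoonup> a) = f h \<rightharpoonup> k a"
    and f\<Phi>: "\<And>h. h \<in> carrier H \<Longrightarrow> \<Phi> (f h) = f (\<Phi> h)"
    and t: "t \<in> carrier HA"
  shows "tensor_map K A H k f (R t) = R (tensor_map K H A f k t)"
proof (rule tensor_eqI[OF vs_H vs_A _ _ _ t])
  note fD = H.bialgebra_endD[OF f]
  note kD = linear_map_closed[OF k]
  show "linear_map K HA AH (\<lambda>t. tensor_map K A H k f (R t))"
    by (rule linear_map_compose[OF R_linear linear_map_tensor_map[OF k fD(1)]])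
  show "linear_map K HA AH (\<lambda>t. R (tensor_map K H A f k t))"
    by (rule linear_map_compose[OF linear_map_tensor_map[OF fD(1) k] R_linear])
  fix h a assume h: "h \<in> carrier H" and a: "a \<in> carrier A"
  have "tensor_map K A H k f (R (pure_tensor K H A h a)) =
      tensor_map K A H (\<lambda>x. k (twisted_action a x)) (\<lambda>y. f (\<psi>\<^sub>H' y)) (\<Delta>\<^sub>H h)"
    using h a
    by (simp add: R_pure tensor_map_compose[OF twisted_action_linear(1) inv_linear(3) k fD(1)] closures)
  also have "\<dots> = tensor_map K A H (\<lambda>x. twisted_action (k a) (f x)) (\<lambda>y. \<psi>\<^sub>H' (f y)) (\<Delta>\<^sub>H h)"
  proof (rule tensor_map_cong)
    show "linear_map K H A (\<lambda>x. k (twisted_action a x))"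
      by (rule linear_map_compose[OF twisted_action_linear(1)[OF a] k])
    show "linear_map K H H (\<lambda>y. f (\<psi>\<^sub>H' y))"
      by (rule linear_map_compose[OF inv_linear(3) fD(1)])
    show "linear_map K H A (\<lambda>x. twisted_action (k a) (f x))"
      by (rule linear_map_compose[OF fD(1) twisted_action_linear(1)[OF kD[OF a]]])
    show "linear_map K H H (\<lambda>y. \<psi>\<^sub>H' (f y))"
      by (rule linear_map_compose[OF fD(1) inv_linear(3)])
    show "k (twisted_action a x) = twisted_action (k a) (f x)" if "x \<in> carrier H" for x
      using that a by (simp add: twisted_action_def fk k\<beta> f\<Phi> closures)
    show "f (\<psi>\<^sub>H' y) = \<psi>\<^sub>H' (f y)" if "y \<in> carrier H" for y
      by (rule H.inv_map_commute[where g=f, OF bij_H(3) fD(2) fD(7) that])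
    show "\<Delta>\<^sub>H h \<in> carrier HH"
      using h by (simp add: closures)
  qed
  also have "\<dots> = tensor_map K A H (twisted_action (k a)) \<psi>\<^sub>H' (\<Delta>\<^sub>H (f h))"
    using h a kD
    by (simp add: fD(4) tensor_map_compose[OF fD(1) fD(1) twisted_action_linear(1) inv_linear(3)] closures)
  also have "\<dots> = R (tensor_map K H A f k (pure_tensor K H A h a))"
    using h a by (simp add: tensor_map_pure[OF fD(1) k] R_pure fD kD)
  finally show "tensor_map K A H k f (R (pure_tensor K H A h a)) = R (tensor_map K H A f k (pure_tensor K H A h a))" .
qed

lemma R_alpha: "t \<in> carrier HA \<Longrightarrow> tensor_map K A H \<alpha>\<^sub>A \<alpha>\<^sub>H (R t) = R (tensor_map K H A \<alpha>\<^sub>H \<alpha>\<^sub>A t)"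
  by (rule R_natural)
    (simp_all add: H.bialgebra_end_structure_maps A.alpha_linear A_commute alpha_act H_commute)

lemma R_beta: "t \<in> carrier HA \<Longrightarrow> tensor_map K A H \<beta>\<^sub>A \<beta>\<^sub>H (R t) = R (tensor_map K H A \<beta>\<^sub>H \<beta>\<^sub>A t)"
  by (rule R_natural)
    (simp_all add: H.bialgebra_end_structure_maps A.beta_linear A_commute beta_act H_commute)

section \<open>Compatibility of \<open>R\<close> with the product of \<open>A\<close>\<close>

lemma R_mult_A:
  assumes t: "t \<in> carrier (tensor K HA A)"
  shows "R (tensor_map K H A \<alpha>\<^sub>H \<mu>\<^sub>A (tensor_assoc K H A A t)) =
      tensor_map K A H \<mu>\<^sub>A \<beta>\<^sub>H (tensor_unassoc K A A H
        (tensor_map K A AH (\<lambda>x. x) R (tensor_assoc K A H A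
          (tensor_map K AH A (tensor_map K A H (\<lambda>x. x) (\<lambda>x. \<alpha>\<^sub>H (\<beta>\<^sub>H' x))) (\<lambda>x. x)
            (tensor_map K AH A R (\<lambda>x. x) t)))))" (is "?lhs t = ?F (tensor_map K AH A R (\<lambda>x. x) t)")
proof (rule tensor_eqI_triple[OF vs_H vs_A vs_A _ _ _ t])
  show "linear_map K (tensor K HA A) AH ?lhs"
    by (rule R_linear_intros | simp add: vs)+
  show "linear_map K (tensor K HA A) AH (\<lambda>t. ?F (tensor_map K AH A R (\<lambda>x. x) t))"
    by (rule R_linear_intros | simp add: vs)+
  fix h a a' assume h: "h \<in> carrier H" and a: "a \<in> carrier A" and a': "a' \<in> carrier A"
  \<comment> \<open>\<open>L\<close> sends \<open>(x \<otimes> y) \<otimes> z\<close> to \<open>(U x) (V y) \<otimes> \<psi>\<^sub>H\<^sup>-\<^sup>1 \<alpha>\<^sub>H \<psi>\<^sub>H\<^sup>-\<^sup>1 z\<close>; the inner \<open>\<psi>\<^sub>H\<^sup>-\<^sup>1\<close> undoes the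
    \<open>\<psi>\<^sub>H\<close> of coassociativity.\<close>
  define U where "U = (\<lambda>x. \<alpha>\<^sub>H' (\<omega>\<^sub>H' (\<Phi> (\<alpha>\<^sub>H x))) \<rightharpoonup> \<beta>\<^sub>A' a)"
  define V where "V = (\<lambda>x. \<beta>\<^sub>H' (\<psi>\<^sub>H' (\<Phi> (\<alpha>\<^sub>H x))) \<rightharpoonup> \<beta>\<^sub>A' a')"
  have UV: "linear_map K H A U" "linear_map K H A V"
    unfolding U_def V_def by (rule linear_intros | simp add: vs closures a a')+
  define L where "L = tensor_map K A H (\<lambda>s. \<mu>\<^sub>A (tensor_map K A A U V s)) (\<lambda>z. \<psi>\<^sub>H' (\<alpha>\<^sub>H (\<psi>\<^sub>H' z)))"
  have L1: "linear_map K HH A (\<lambda>s. \<mu>\<^sub>A (tensor_map K A A U V s))"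
    by (rule linear_intros UV | simp add: vs)+
  have L2: "linear_map K H H (\<lambda>z. \<psi>\<^sub>H' (\<alpha>\<^sub>H (\<psi>\<^sub>H' z)))"
    by (rule linear_intros | simp add: vs)+
  have L: "linear_map K (tensor K HH H) AH L"
    unfolding L_def by (rule linear_map_tensor_map[OF L1 L2])
  note L_pure = tensor_map_pure[OF L1 L2, folded L_def]
  have prod: "a \<diamondop> a' \<in> carrier A"
    using a a' by (rule closed)
  have \<Phi>\<alpha>: "H.bialgebra_end (\<lambda>x. \<Phi> (\<alpha>\<^sub>H x))"
    by (rule H.bialgebra_end_compose[OF \<Phi>_end H.bialgebra_end_structure_maps(1)])
  \<comment> \<open>This is \<open>act_mult\<close> at \<open>\<Phi> (\<alpha>\<^sub>H x)\<close>.
    Comultiplicativity of \<open>\<Phi>\<close> after \<open>\<alpha>\<^sub>H\<close> pushes this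
    map onto the legs of \<open>\<Delta>\<^sub>H x\<close>, which is why it occurs inside
    \<open>U\<close> and \<open>V\<close>.\<close>
  have step: "\<Phi> (\<alpha>\<^sub>H x) \<rightharpoonup> \<beta>\<^sub>A' (a \<diamondop> a') = \<mu>\<^sub>A (tensor_map K A A U V (\<Delta>\<^sub>H x))" if x: "x \<in> carrier H" for x
  proof -
    have lin: "linear_map K H A (\<lambda>y. \<alpha>\<^sub>H' (\<omega>\<^sub>H' y) \<rightharpoonup> \<beta>\<^sub>A' a)" "linear_map K H A (\<lambda>y. \<beta>\<^sub>H' (\<psi>\<^sub>H' y) \<rightharpoonup> \<beta>\<^sub>A' a')"
      by (rule linear_intros | simp add: vs closures a a')+
    show ?thesis
      using x a a' by (simp add: A_commute act_mult closures H.bialgebra_endD(4)[OF \<Phi>\<alpha>] U_def V_def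
        tensor_map_compose[OF H.bialgebra_endD(1)[OF \<Phi>\<alpha>] H.bialgebra_endD(1)[OF \<Phi>\<alpha>] lin])
  qed
  \<comment> \<open>The coproduct of \<open>\<alpha>\<^sub>H h\<close> is written with
    \<open>\<alpha>\<^sub>H\<close> on both legs, so that the next comparison is linear in
    \<open>\<Delta>\<^sub>H h\<close>.\<close>
  have "?lhs (pure_tensor K HA A (pure_tensor K H A h a) a') =
      tensor_map K A H (twisted_action (a \<diamondop> a')) \<psi>\<^sub>H' (tensor_map K H H \<alpha>\<^sub>H \<alpha>\<^sub>H (\<Delta>\<^sub>H h))"
    using h a a' by (simp add: tensor_simps closures pure_tensor_closed H.alpha_comult)
  also have "\<dots> = L (tensor_map K HH H \<Delta>\<^sub>H \<psi>\<^sub>H (\<Delta>\<^sub>H h))"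
  proof (rule tensor_eqI[OF vs_H vs_H])
    show "linear_map K HH AH (\<lambda>t. tensor_map K A H (twisted_action (a \<diamondop> a')) \<psi>\<^sub>H' (tensor_map K H H \<alpha>\<^sub>H \<alpha>\<^sub>H t))"
      by (rule R_linear_intros prod | simp add: vs prod)+
    show "linear_map K HH AH (\<lambda>t. L (tensor_map K HH H \<Delta>\<^sub>H \<psi>\<^sub>H t))"
      by (rule linear_map_compose[OF _ L] linear_intros | simp add: vs)+
    show "\<Delta>\<^sub>H h \<in> carrier HH"
      using h by (simp add: closures)
    show "tensor_map K A H (twisted_action (a \<diamondop> a')) \<psi>\<^sub>H' (tensor_map K H H \<alpha>\<^sub>H \<alpha>\<^sub>H (pure_tensor K H H x y)) =
        L (tensor_map K HH H \<Delta>\<^sub>H \<psi>\<^sub>H (pure_tensor K H H x y))"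
      if "x \<in> carrier H" "y \<in> carrier H" for x y
      using that prod by (simp add: tensor_simps closures L_pure step[symmetric]) (simp add: twisted_action_def H_commute)
  qed
  \<comment> \<open>Coassociativity; \<open>tensor_unassoc\<close> returns to the nesting on which
    \<open>L\<close> is defined.\<close>
  also have "\<dots> = L (tensor_unassoc K H H H (tensor_map K H HH \<omega>\<^sub>H \<Delta>\<^sub>H (\<Delta>\<^sub>H h)))"
    using h by (simp add: H.bihom_coassoc[symmetric] tensor_unassoc_assoc vs closures
        linear_map_closed[OF linear_map_tensor_map[OF H.comult_linear H.psi_linear]])
  also have "\<dots> = ?F (pure_tensor K AH A (tensor_map K A H (twisted_action a) \<psi>\<^sub>H' (\<Delta>\<^sub>H h)) a')"
  proof (rule tensor_eqI[OF vs_H vs_H])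
    show "linear_map K HH AH (\<lambda>t. L (tensor_unassoc K H H H (tensor_map K H HH \<omega>\<^sub>H \<Delta>\<^sub>H t)))"
      by (rule linear_map_compose[OF _ L] linear_intros | simp add: vs)+
    show "linear_map K HH AH (\<lambda>t. ?F (pure_tensor K AH A (tensor_map K A H (twisted_action a) \<psi>\<^sub>H' t) a'))"
      by (rule R_linear_intros | simp add: vs a a')+
    show "\<Delta>\<^sub>H h \<in> carrier HH"
      using h by (simp add: closures)
    fix x y assume x: "x \<in> carrier H" and y: "y \<in> carrier H"
    let ?y = "\<alpha>\<^sub>H (\<beta>\<^sub>H' (\<psi>\<^sub>H' y))"
    \<comment> \<open>What happens to \<open>y\<close> before the second application of
      \<open>R\<close>: \<open>\<psi>\<^sub>H'\<close> comes from the first application, the rest is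
      the middle factor of the twisting condition. Being comultiplicative, \<open>?k\<close> can be
      moved onto the legs of \<open>\<Delta>\<^sub>H y\<close>.\<close>
    let ?k = "\<lambda>y. \<alpha>\<^sub>H (\<beta>\<^sub>H' (\<psi>\<^sub>H' y))"
    have k: "H.bialgebra_end ?k"
      by (intro H.bialgebra_end_compose[OF H.bialgebra_end_structure_maps(1)]
          H.bialgebra_end_compose[OF \<beta>'_end \<psi>'_end])
    have "L (tensor_unassoc K H H H (tensor_map K H HH \<omega>\<^sub>H \<Delta>\<^sub>H (pure_tensor K H H x y))) =
        L (tensor_unassoc K H H H (pure_tensor K H HH (\<omega>\<^sub>H x) (\<Delta>\<^sub>H y)))"
      using x y by (simp add: tensor_simps)
    also have "\<dots> = tensor_map K A H \<mu>\<^sub>A \<beta>\<^sub>H (tensor_unassoc K A A H (pure_tensor K A AH (twisted_action a x)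
        (tensor_map K A H (twisted_action a') \<psi>\<^sub>H' (tensor_map K H H ?k ?k (\<Delta>\<^sub>H y)))))"
    proof -
      \<comment> \<open>The remaining coproduct \<open>\<Delta>\<^sub>H y\<close> is treated in the
        same way: both sides are linear in it, so a pure tensor of \<open>z\<close> and
        \<open>z'\<close> may replace it.\<close>
      have l1: "linear_map K HH AH (\<lambda>t. L (tensor_unassoc K H H H (pure_tensor K H HH (\<omega>\<^sub>H x) t)))"
        by (rule linear_map_compose[OF _ L] linear_intros | simp add: vs closures x)+
      have l2: "linear_map K HH AH (\<lambda>t. tensor_map K A H \<mu>\<^sub>A \<beta>\<^sub>H (tensor_unassoc K A A H (pure_tensor K A AH
          (twisted_action a x) (tensor_map K A H (twisted_action a') \<psi>\<^sub>H' (tensor_map K H H ?k ?k t)))))"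
        by (rule R_linear_intros | simp add: vs twisted_action_closed a a' x)+
      show ?thesis
      proof (rule tensor_eqI[OF vs_H vs_H l1 l2])
        show "\<Delta>\<^sub>H y \<in> carrier HH"
          using y by (simp add: closures)
        fix z z' assume z: "z \<in> carrier H" "z' \<in> carrier H"
        \<comment> \<open>In \<open>U\<close> the inverses cancel the
          \<open>\<omega>\<^sub>H\<close> on \<open>x\<close> and the inner
          \<open>\<alpha>\<^sub>H\<close>, leaving \<open>twisted_action a x\<close>.
          \<open>V z\<close> equals \<open>twisted_action a' (?k z)\<close>, and on the last leg the
          outer \<open>\<beta>\<^sub>H\<close> cancels the inverse inside \<open>?k\<close>.\<close>
        show "L (tensor_unassoc K H H H (pure_tensor K H HH (\<omega>\<^sub>H x) (pure_tensor K H H z z'))) =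
          tensor_map K A H \<mu>\<^sub>A \<beta>\<^sub>H (tensor_unassoc K A A H (pure_tensor K A AH
            (twisted_action a x) (tensor_map K A H (twisted_action a') \<psi>\<^sub>H' (tensor_map K H H ?k ?k (pure_tensor K H H z z')))))"
          using x z a a'
          by (simp add: tensor_simps tensor_map_pure[OF H.bialgebra_endD(1)[OF k] H.bialgebra_endD(1)[OF k]]
              UV closures twisted_action_closed L_pure)
            (simp add: U_def V_def twisted_action_def H_commute closures)
      qed
    qed
    also have "\<dots> = ?F (pure_tensor K AH A (tensor_map K A H (twisted_action a) \<psi>\<^sub>H' (pure_tensor K H H x y)) a')"
      using x y a a' by (simp add: tensor_simps closures pure_tensor_closed twisted_action_closed
        H.bialgebra_endD(4)[OF k])
    finally show "L (tensor_unassoc K H H H (tensor_map K H HH \<omega>\<^sub>H \<Delta>\<^sub>H (pure_tensor K H H x y))) =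
      ?F (pure_tensor K AH A (tensor_map K A H (twisted_action a) \<psi>\<^sub>H' (pure_tensor K H H x y)) a')" .
  qed
  also have "\<dots> = ?F (tensor_map K AH A R (\<lambda>x. x) (pure_tensor K HA A (pure_tensor K H A h a) a'))"
    using h a a' by (simp add: tensor_simps closures pure_tensor_closed)
  finally show "?lhs (pure_tensor K HA A (pure_tensor K H A h a) a') =
    ?F (tensor_map K AH A R (\<lambda>x. x) (pure_tensor K HA A (pure_tensor K H A h a) a'))" .
qed


section \<open>Compatibility of \<open>R\<close> with the product of \<open>H\<close>\<close>

text \<open>\<open>comult_mult\<close> describes the product of two coproducts by lifting this
  expression in \<open>x\<close> and \<open>y\<close>. As they occur inside the tensored maps,
  linearity in either is obtained by reading the expression as a lift in \<open>s\<close> with that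
  variable as parameter.\<close>

lemma comult_mult_bilinear:
  assumes s: "s \<in> carrier HH"
  shows "bilinear_map K H H HH (\<lambda>x y. tensor_map K H H (\<lambda>x'. x \<star> x') (\<lambda>y'. y \<star> y') s)"
proof (rule bilinear_mapI)
  have l: "linear_map K H H (\<lambda>x. x \<star> y)" "linear_map K H H (\<lambda>x. y \<star> x)" if "y \<in> carrier H" for y
    by (rule linear_intros | simp add: vs that)+
  have b: "bilinear_map K H H HH (\<lambda>x' y'. pure_tensor K H H (x \<star> x') (y \<star> y'))"
    if "x \<in> carrier H" "y \<in> carrier H" for x y
    using that by (intro bilinear_map_compose[OF bilinear_map_pure_tensor[OF vs_H vs_H]] l)
  show "linear_map K H HH (\<lambda>x. tensor_map K H H (\<lambda>x'. x \<star> x') (\<lambda>y'. y \<star> y') s)"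
    if y: "y \<in> carrier H" for y
    unfolding tensor_map_def
    by (rule bilinear_map_right[OF bilinear_map_tensor_lift[OF vs_H b[OF _ y]] s])
      (rule linear_intros | simp add: vs y closures)+
  show "linear_map K H HH (\<lambda>y. tensor_map K H H (\<lambda>x'. x \<star> x') (\<lambda>y'. y \<star> y') s)"
    if x: "x \<in> carrier H" for x
    unfolding tensor_map_def
    by (rule bilinear_map_right[OF bilinear_map_tensor_lift[OF vs_H b[OF x]] s])
      (rule linear_intros | simp add: vs x closures)+
qed (simp_all add: vs)

lemma R_mult_B:
  assumes t: "t \<in> carrier (tensor K HH A)"
  shows "R (tensor_map K H A \<mu>\<^sub>H \<beta>\<^sub>A t) =
      tensor_map K A H \<alpha>\<^sub>A \<mu>\<^sub>H (tensor_assoc K A H H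
        (tensor_map K AH H R (\<lambda>x. x) (tensor_unassoc K H A H
          (tensor_map K H AH (\<lambda>x. x) (tensor_map K A H (\<lambda>a. \<alpha>\<^sub>A' (\<beta>\<^sub>A a)) (\<lambda>x. x))
            (tensor_map K H AH (\<lambda>x. x) R (tensor_assoc K H H A t))))))"
    (is "?lhs t = ?F (tensor_map K H AH (\<lambda>x. x) R (tensor_assoc K H H A t))")
proof (rule tensor_eqI_triple[OF vs_H vs_H vs_A _ _ _ t])
  show "linear_map K (tensor K HH A) AH ?lhs"
    by (rule R_linear_intros | simp add: vs)+
  show "linear_map K (tensor K HH A) AH (\<lambda>t. ?F (tensor_map K H AH (\<lambda>x. x) R (tensor_assoc K H H A t)))"
    by (rule R_linear_intros | simp add: vs)+
  fix h h' a assume h: "h \<in> carrier H" and h': "h' \<in> carrier H" and a: "a \<in> carrier A"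
  \<comment> \<open>\<open>?M s t\<close> is the product \<open>t s\<close> in \<open>H \<otimes> H\<close>.\<close>
  let ?M = "\<lambda>s t. tensor_lift K HH (\<lambda>x y. tensor_map K H H (\<lambda>x'. x \<star> x') (\<lambda>y'. y \<star> y') s) t"
  let ?T = "tensor_map K A H (twisted_action (\<beta>\<^sub>A a)) \<psi>\<^sub>H'"
  have b: "linear_map K H H (\<lambda>y. x \<star> y)" if "x \<in> carrier H" for x
    by (rule linear_intros | simp add: vs that)+
  \<comment> \<open>Linearity in the factor \<open>s\<close> is needed as well, because
    \<open>\<Delta>\<^sub>H h'\<close> is expanded first while \<open>\<Delta>\<^sub>H h\<close>
    stays in place.\<close>
  have M_bilinear: "bilinear_map K HH HH HH (\<lambda>t s. ?M s t)"
    by (rule bilinear_map_tensor_lift[OF _ comult_mult_bilinear linear_map_tensor_map])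
      (simp_all add: vs b)
  have \<beta>a: "\<beta>\<^sub>A a \<in> carrier A"
    using a by (simp add: closures)
  have comult_h: "\<Delta>\<^sub>H h \<in> carrier HH" and comult_h': "\<Delta>\<^sub>H h' \<in> carrier HH"
    using h h' by (simp_all add: closures)
  have "?lhs (pure_tensor K HH A (pure_tensor K H H h h') a) = ?T (?M (\<Delta>\<^sub>H h') (\<Delta>\<^sub>H h))"
    using h h' a by (simp add: tensor_simps closures pure_tensor_closed H.comult_mult)
  also have "\<dots> = ?F (pure_tensor K H AH h (tensor_map K A H (twisted_action a) \<psi>\<^sub>H' (\<Delta>\<^sub>H h')))"
  proof -
    have l1: "linear_map K HH AH (\<lambda>s. ?T (?M s (\<Delta>\<^sub>H h)))"
      by (rule linear_map_compose[OF bilinear_map_right[OF M_bilinear comult_h]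
            linear_map_tensor_map[OF twisted_action_linear(1)[OF \<beta>a] inv_linear(3)]])
    have l2: "linear_map K HH AH
        (\<lambda>s. ?F (pure_tensor K H AH h (tensor_map K A H (twisted_action a) \<psi>\<^sub>H' s)))"
      by (rule R_linear_intros | simp add: vs h a)+
    show ?thesis
    \<comment> \<open>The coproduct of \<open>h'\<close> goes first because on the right-hand side
      \<open>R\<close> first meets \<open>h'\<close> and \<open>a\<close>, and the element that
      \<open>h\<close> then acts on depends on the leg \<open>x'\<close>.\<close>
    proof (rule tensor_eqI[OF vs_H vs_H l1 l2 _ comult_h'])
      fix x' y' assume x': "x' \<in> carrier H" and y': "y' \<in> carrier H"
      \<comment> \<open>The input from \<open>A\<close> to the second application of
        \<open>R\<close>: the output of the first one, corrected by the middle factor of the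
        twisting condition.\<close>
      let ?X = "\<alpha>\<^sub>A' (\<beta>\<^sub>A (twisted_action a x'))"
      have X: "?X \<in> carrier A" and pure: "pure_tensor K H H x' y' \<in> carrier HH"
        using a x' y' by (simp_all add: closures twisted_action_closed)
      note M = tensor_lift[OF comult_mult_bilinear[OF pure]]
      have l3: "linear_map K HH AH (\<lambda>t. ?T (?M (pure_tensor K H H x' y') t))"
        by (rule linear_map_compose[OF M(1)
            linear_map_tensor_map[OF twisted_action_linear(1)[OF \<beta>a] inv_linear(3)]])
      have l4: "linear_map K HH AH (\<lambda>t. tensor_map K A H \<alpha>\<^sub>A \<mu>\<^sub>H (tensor_assoc K A H H
          (pure_tensor K AH H (tensor_map K A H (twisted_action ?X) \<psi>\<^sub>H' t) (\<psi>\<^sub>H' y'))))"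
        by (rule R_linear_intros | simp add: vs X y' closures)+
      have "?T (?M (pure_tensor K H H x' y') (\<Delta>\<^sub>H h)) = tensor_map K A H \<alpha>\<^sub>A \<mu>\<^sub>H (tensor_assoc K A H H
          (pure_tensor K AH H (tensor_map K A H (twisted_action ?X) \<psi>\<^sub>H' (\<Delta>\<^sub>H h)) (\<psi>\<^sub>H' y')))"
      proof (rule tensor_eqI[OF vs_H vs_H l3 l4 _ comult_h])
        fix x y assume x: "x \<in> carrier H" and y: "y \<in> carrier H"
        \<comment> \<open>Writing \<open>a\<close> as
          \<open>\<beta>\<^sub>A (\<beta>\<^sub>A' a)\<close> lets \<open>act_act\<close>, read
          backwards, split the action of the product. The correction in \<open>?X\<close> makes
          \<open>\<alpha>\<^sub>A (\<beta>\<^sub>A' ?X)\<close> equal to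
          \<open>twisted_action a x'\<close>, so \<open>alpha_act\<close> gives the outer
          \<open>\<alpha>\<^sub>A\<close>.\<close>
        have "\<Phi> (x \<star> x') \<rightharpoonup> a = \<alpha>\<^sub>A (\<Phi> x \<rightharpoonup> \<beta>\<^sub>A' ?X)"
        proof -
          have c: "\<beta>\<^sub>A' a \<in> carrier A" "\<Phi> x \<in> carrier H" "\<Phi> x' \<in> carrier H"
            using a x x' by (simp_all add: closures)
          have "\<Phi> (x \<star> x') \<rightharpoonup> a = (\<Phi> x \<star> \<Phi> x') \<rightharpoonup> \<beta>\<^sub>A (\<beta>\<^sub>A' a)"
            using a x x' by (simp add: H.bialgebra_endD(3)[OF \<Phi>_end] A_commute)
          also have "\<dots> = \<alpha>\<^sub>H (\<Phi> x) \<rightharpoonup> twisted_action a x'"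
            using c by (simp add: act_act twisted_action_def)
          also have "\<dots> = \<alpha>\<^sub>A (\<Phi> x \<rightharpoonup> \<beta>\<^sub>A' ?X)"
            \<comment> \<open>The reversed rule brings \<open>\<alpha>\<^sub>A\<close> next to its
              inverse. The cancellations follow in a second call, since the rule and its reverse
              would loop together.\<close>
            using a c x' by (simp add: alpha_act closures twisted_action_closed A_commute(4)[symmetric])
              (simp add: closures twisted_action_closed A_commute)
          finally show ?thesis .
        qed
        then show "?T (?M (pure_tensor K H H x' y') (pure_tensor K H H x y)) =
          tensor_map K A H \<alpha>\<^sub>A \<mu>\<^sub>H (tensor_assoc K A H H
          (pure_tensor K AH H (tensor_map K A H (twisted_action ?X) \<psi>\<^sub>H' (pure_tensor K H H x y)) (\<psi>\<^sub>H' y')))"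
          using a x y x' y' X \<beta>a
          by (simp add: M(2) tensor_simps closures b twisted_action_closed
              H.bialgebra_endD(3)[OF \<psi>'_end])
            (simp add: twisted_action_def A_commute)
      qed
      also have "\<dots> = ?F (pure_tensor K H AH h (tensor_map K A H (twisted_action a) \<psi>\<^sub>H' (pure_tensor K H H x' y')))"
        using h a x' y' X by (simp add: tensor_simps closures pure_tensor_closed twisted_action_closed)
      finally show "?T (?M (pure_tensor K H H x' y') (\<Delta>\<^sub>H h)) =
        ?F (pure_tensor K H AH h (tensor_map K A H (twisted_action a) \<psi>\<^sub>H' (pure_tensor K H H x' y')))" .
    qed
  qed
  also have "\<dots> = ?F (tensor_map K H AH (\<lambda>x. x) R (tensor_assoc K H H A
      (pure_tensor K HH A (pure_tensor K H H h h') a)))"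
    using h h' a by (simp add: tensor_simps closures pure_tensor_closed)
  finally show "?lhs (pure_tensor K HH A (pure_tensor K H H h h') a) =
    ?F (tensor_map K H AH (\<lambda>x. x) R (tensor_assoc K H H A
      (pure_tensor K HH A (pure_tensor K H H h h') a)))" .
qed

lemma R_twisting: "bihom_twisting_map K A \<mu>\<^sub>A \<alpha>\<^sub>A \<beta>\<^sub>A H \<mu>\<^sub>H \<alpha>\<^sub>H \<beta>\<^sub>H R"
  \<comment> \<open>The conditions of the locale are phrased with \<open>id\<close> and
    \<open>\<circ>\<close>, the lemmas above with abstractions; unfolding makes them match.\<close>
  by (intro bihom_twisting_map.intro bihom_twisting_map_axioms.intro A.bihom_algebra_axioms
      H.bihom_algebra_axioms)
    (simp_all add: bij_A bij_H R_linear R_alpha R_beta R_mult_A R_mult_B id_def comp_def)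

end

theorem theorem8p1:
  fixes K :: "'k ring"
    and H :: "('k, 'h) module" and A :: "('k, 'a) module"
    and \<mu>\<^sub>H :: "('h \<times> 'h \<Rightarrow> 'k) set \<Rightarrow> 'h" and \<Delta>\<^sub>H :: "'h \<Rightarrow> ('h \<times> 'h \<Rightarrow> 'k) set"
    and \<alpha>\<^sub>H \<beta>\<^sub>H \<psi>\<^sub>H \<omega>\<^sub>H :: "'h \<Rightarrow> 'h"
    and \<mu>\<^sub>A :: "('a \<times> 'a \<Rightarrow> 'k) set \<Rightarrow> 'a" and \<alpha>\<^sub>A \<beta>\<^sub>A :: "'a \<Rightarrow> 'a"
    and act :: "('h \<times> 'a \<Rightarrow> 'k) set \<Rightarrow> 'a"
    and m n p :: int
  assumes "vectorspace K H" and "vectorspace K A"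
    and "bihom_bialgebra K H \<mu>\<^sub>H \<Delta>\<^sub>H \<alpha>\<^sub>H \<beta>\<^sub>H \<psi>\<^sub>H \<omega>\<^sub>H"
    and "bij_map H \<alpha>\<^sub>H" and "bij_map H \<beta>\<^sub>H" and "bij_map H \<psi>\<^sub>H" and "bij_map H \<omega>\<^sub>H"
    and "left_module_bihom_algebra K H \<mu>\<^sub>H \<Delta>\<^sub>H \<alpha>\<^sub>H \<beta>\<^sub>H \<psi>\<^sub>H \<omega>\<^sub>H A \<mu>\<^sub>A \<alpha>\<^sub>A \<beta>\<^sub>A act"
    and "bij_map A \<alpha>\<^sub>A" and "bij_map A \<beta>\<^sub>A"
  shows "bihom_twisting_map K A \<mu>\<^sub>A \<alpha>\<^sub>A \<beta>\<^sub>A H \<mu>\<^sub>H \<alpha>\<^sub>H \<beta>\<^sub>H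
    (R_map K H \<Delta>\<^sub>H \<alpha>\<^sub>H \<beta>\<^sub>H \<psi>\<^sub>H \<omega>\<^sub>H A \<beta>\<^sub>A act m n p)"
proof -
  interpret left_module_bihom_algebra K H \<mu>\<^sub>H \<Delta>\<^sub>H \<alpha>\<^sub>H \<beta>\<^sub>H \<psi>\<^sub>H \<omega>\<^sub>H A \<mu>\<^sub>A \<alpha>\<^sub>A \<beta>\<^sub>A act
    by fact
  interpret twisting_data K H \<mu>\<^sub>H \<Delta>\<^sub>H \<alpha>\<^sub>H \<beta>\<^sub>H \<psi>\<^sub>H \<omega>\<^sub>H A \<mu>\<^sub>A \<alpha>\<^sub>A \<beta>\<^sub>A act m n p
    by unfold_locales fact+
  show ?thesis
    by (rule R_twisting)
qed

end
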